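(* Let $\Omega=(0,1)^2$, $\Gamma=\partial\Omega$, and let $u$ be the solution of $-\Delta u=f$ in $\Omega$, $u|_\Gamma=0$. Assume $u\in C^4(\bar\Omega)$. Then there is a constant $c>0$, independent of the mesh $\tau$, such that for every admissible mesh $\tau$ of $\Omega$ of size $h$, the corrected finite volume approximation $u_1^h=(u^1_{ij})$ (defined in the context) satisfies $$\|e^1\|_{1,\tau}\le c\,h^2\|u\|_{4,\infty,\bar\Omega},$$ $$\Big(\sum_{i=0}^{M}\sum_{j=0}^{N}k_jh_{i+\frac12}(e^1_{ij})^2\Big)^{\frac12}\le c\,h^2\|u\|_{4,\infty,\bar\Omega},$$ $$\|e^1\|_{L^2}\le c\,h^2\|u\|_{4,\infty,\bar\Omega},$$ where $e^1_{ij}=u(x_i,y_j)-u^1_{ij}$ for $(i,j)\in\{1,\dots,M\}\times\{1,\dots,N\}$ and $e^1_{ij}=0$ elsewhere. (This is an $O(h)$ improvement over the basic finite volume solution $u^h$, defined in the context, whose error is $O(h)$.)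
   Context: **Norms and notation.** $\|w\|_{m,\infty,\bar\Omega}=\max_{|a|\le m}\max_{\bar\Omega}|D^aw|$. Subscripts denote partial derivatives, e.g. $u_{2x}=\partial_x^2u$. Since $u\in C^4(\bar\Omega)$, $f=-\Delta u$ is regarded as a $C^2$ function on $\bar\Omega$. **Admissible mesh $\tau$.** $M,N\in\mathbb N^*$; $(h_i)_{i=1}^M,(k_j)_{j=1}^N$ positive with $\sum h_i=\sum k_j=1$; $h_0=h_{M+1}=k_0=k_{N+1}=0$; $x_{\frac12}=y_{\frac12}=0$, $x_{i+\frac12}=x_{i-\frac12}+h_i$, $y_{j+\frac12}=y_{j-\frac12}+k_j$; $K_{ij}=[x_{i-\frac12},x_{i+\frac12}]\times[y_{j-\frac12},y_{j+\frac12}]$. Points $x_0=0$, $x_{M+1}=1$, $y_0=0$, $y_{N+1}=1$, $x_{i-\frac12}<x_i<x_{i+\frac12}$ ($1\le i\le M$), $y_{j-\frac12}<y_j<y_{j+\frac12}$ ($1\le j\le N$). $h_i^-=x_i-x_{i-\frac12}$, $h_i^+=x_{i+\frac12}-x_i$, $k_j^-=y_j-y_{j-\frac12}$, $k_j^+=y_{j+\frac12}-y_j$; $h_0^+=h_{M+1}^-=k_0^+=k_{N+1}^-=0$; $h_{i+\frac12}=x_{i+1}-x_i$ ($0\le i\le M$), $k_{j+\frac12}=y_{j+1}-y_j$ ($0\le j\le N$). Size: $h=\max\{h_i,k_j\}$. **Discrete norms and operators.** For $w=(w_{ij})_{0\le i\le M+1,\,0\le j\le N+1}$, $$\|w\|_{1,\tau}=\Big(\sum_{i=0}^M\sum_{j=0}^Nk_j\frac{(w_{i+1,j}-w_{ij})^2}{h_{i+\frac12}}+\sum_{i=0}^M\sum_{j=0}^Nh_i\frac{(w_{i,j+1}-w_{ij})^2}{k_{j+\frac12}}\Big)^{\frac12},\qquad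 \|w\|_{L^2}=\Big(\sum_{i=0}^M\sum_{j=0}^Nh_ik_jw_{ij}^2\Big)^{\frac12},$$ $$(\Delta^\tau w)_{ij}=-k_j\Big(\frac{w_{i+1,j}-w_{ij}}{h_{i+\frac12}}-\frac{w_{ij}-w_{i-1,j}}{h_{i-\frac12}}\Big)-h_i\Big(\frac{w_{i,j+1}-w_{ij}}{k_{j+\frac12}}-\frac{w_{ij}-w_{i,j-1}}{k_{j-\frac12}}\Big),$$ $$\partial_1^xw_{ij}=\frac{w_{i+1,j}-w_{ij}}{h_{i+\frac12}},\qquad\partial_1^yw_{ij}=\frac{w_{i,j+1}-w_{ij}}{k_{j+\frac12}}.$$ **Basic solution** $u^h=(u_{ij})$: $u_{0j}=u_{M+1,j}=u_{i0}=u_{i,N+1}=0$ and $(\Delta^\tau u^h)_{ij}=\int_{K_{ij}}f\,dx\,dy$ for $1\le i\le M$, $1\le j\le N$. **Approximation $v^h=(v_{ij})$ of $u_{2x}$:** $v_{i0}=v_{i,N+1}=0$, $v_{0j}=-f(0,y_j)$, $v_{M+1,j}=-f(1,y_j)$, and $(\Delta^\tau v^h)_{ij}=\int_{K_{ij}}f_{2x}\,dx\,dy$ for $1\le i\le M$, $1\le j\le N$. **First correction** $u_1^h=(u_{ij}^1)$: $u^1_{0j}=u^1_{M+1,j}=u^1_{i0}=u^1_{i,N+1}=0$ and for $1\le i\le M$, $1\le j\le N$ $$(\Delta^\tau u_1^h)_{ij}=\int_{K_{ij}}f\,dx\,dy+(\gamma_{i+\frac12,j}-\gamma_{i-\frac12,j})+(\gamma_{i,j+\frac12}-\gamma_{i,j-\frac12})+\delta_{ij},$$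 where $$\gamma_{i+\frac12,j}=-k_j\frac{h_{i+1}^--h_i^+}{2}v_{ij},\qquad \gamma_{i,j+\frac12}=-h_i\frac{k_{j+1}^--k_j^+}{2}\big(-f(x_i,y_{j+\frac12})-v_{ij}\big),$$ $$\begin{aligned}\delta_{ij}=\;&h_i\frac{(k_j^+)^2}{2}\partial_1^yv_{ij}-h_i\frac{(k_j^-)^2}{2}\partial_1^yv_{i,j-1}+k_j\frac{(h_i^+)^2}{2}\big(-f_x(x_i,y_j)-\partial_1^xv_{ij}\big)\\&-k_j\frac{(h_i^-)^2}{2}\big(-f_x(x_{i-1},y_j)-\partial_1^xv_{i-1,j}\big).\end{aligned}$$ *)

theory Defs
  imports "HOL-Analysis.Analysis"
begin

definition Omega :: "(real \<times> real) set" where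
  "Omega = {0<..<1} \<times> {0<..<1}"

definition Omega_bar :: "(real \<times> real) set" where
  "Omega_bar = {0..1} \<times> {0..1}"

text \<open>
  Partial derivatives on the closed square: at boundary points they are one-sided, which
  for functions of class \<open>C\<^sup>k\<close> on the closed square agrees with the continuous extension
  of the derivative from the interior.
\<close>

definition pdx :: "(real \<times> real \<Rightarrow> real) \<Rightarrow> real \<times> real \<Rightarrow> real" where
  "pdx g = (\<lambda>(x, y). vector_derivative (\<lambda>t. g (t, y)) (at x within {0..1}))"

definition pdy :: "(real \<times> real \<Rightarrow> real) \<Rightarrow> real \<times> real \<Rightarrow> real" where
  "pdy g = (\<lambda>(x, y). vector_derivative (\<lambda>t. g (x, t)) (at y within {0..1}))"

definition has_partials :: "(real \<times> real \<Rightarrow> real) \<Rightarrow> bool" where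
  "has_partials g \<longleftrightarrow> (\<forall>x\<in>{0..1}. \<forall>y\<in>{0..1}.
     (\<lambda>t. g (t, y)) differentiable (at x within {0..1}) \<and>
     (\<lambda>t. g (x, t)) differentiable (at y within {0..1}))"

text \<open>\<open>C_bar k g\<close>: all iterated partial derivatives of order at most \<open>k\<close>, in any order of
  differentiation, exist and are continuous on the closed square.\<close>

primrec C_bar :: "nat \<Rightarrow> (real \<times> real \<Rightarrow> real) \<Rightarrow> bool" where
  "C_bar 0 g \<longleftrightarrow> continuous_on Omega_bar g"
| "C_bar (Suc k) g \<longleftrightarrow>
     continuous_on Omega_bar g \<and> has_partials g \<and> C_bar k (pdx g) \<and> C_bar k (pdy g)"

definition laplacian :: "(real \<times> real \<Rightarrow> real) \<Rightarrow> real \<times> real \<Rightarrow> real" where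
  "laplacian g p = pdx (pdx g) p + pdy (pdy g) p"

text \<open>The inner supremum is a maximum when \<open>w\<close> is of class \<open>C\<^sup>m\<close> on the closed square.\<close>

definition max_norm :: "nat \<Rightarrow> (real \<times> real \<Rightarrow> real) \<Rightarrow> real" where
  "max_norm m w =
     Max ((\<lambda>(a, b). SUP p\<in>Omega_bar. \<bar>(pdx ^^ a) ((pdy ^^ b) w) p\<bar>) ` {(a, b). a + b \<le> m})"

text \<open>
  A mesh is given by \<open>M\<close>, \<open>N\<close>, the widths \<open>h\<^sub>i\<close>, \<open>k\<^sub>j\<close> and the points \<open>x\<^sub>i\<close>, \<open>y\<^sub>j\<close>.
  Quantities with index \<open>i + 1/2\<close> are represented by functions of \<open>i\<close>, so that the index
  \<open>i - 1/2\<close> becomes \<open>i - 1\<close>; this is used for \<open>i \<ge> 1\<close> only.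
\<close>

record mesh =
  mM :: nat
  mN :: nat
  mh :: "nat \<Rightarrow> real"
  mk :: "nat \<Rightarrow> real"
  mx :: "nat \<Rightarrow> real"
  my :: "nat \<Rightarrow> real"

definition x_half :: "mesh \<Rightarrow> nat \<Rightarrow> real" where
  "x_half T i = (\<Sum>l=1..i. mh T l)"

definition y_half :: "mesh \<Rightarrow> nat \<Rightarrow> real" where
  "y_half T j = (\<Sum>l=1..j. mk T l)"

definition admissible_mesh :: "mesh \<Rightarrow> bool" where
  "admissible_mesh T \<longleftrightarrow>
     mM T \<ge> 1 \<and> mN T \<ge> 1 \<and>
     (\<forall>i\<in>{1..mM T}. mh T i > 0) \<and> (\<forall>j\<in>{1..mN T}. mk T j > 0) \<and>
     (\<Sum>i=1..mM T. mh T i) = 1 \<and> (\<Sum>j=1..mN T. mk T j) = 1 \<and>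
     mh T 0 = 0 \<and> mh T (mM T + 1) = 0 \<and> mk T 0 = 0 \<and> mk T (mN T + 1) = 0 \<and>
     mx T 0 = 0 \<and> mx T (mM T + 1) = 1 \<and> my T 0 = 0 \<and> my T (mN T + 1) = 1 \<and>
     (\<forall>i\<in>{1..mM T}. x_half T (i - 1) < mx T i \<and> mx T i < x_half T i) \<and>
     (\<forall>j\<in>{1..mN T}. y_half T (j - 1) < my T j \<and> my T j < y_half T j)"

definition mesh_size :: "mesh \<Rightarrow> real" where
  "mesh_size T = Max (mh T ` {1..mM T} \<union> mk T ` {1..mN T})"

definition cell :: "mesh \<Rightarrow> nat \<Rightarrow> nat \<Rightarrow> (real \<times> real) set" where
  "cell T i j = {x_half T (i - 1)..x_half T i} \<times> {y_half T (j - 1)..y_half T j}"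

text \<open>
  On an admissible mesh these formulas also give the boundary conventions
  \<open>h\<^sub>0\<^sup>+ = 0\<close>, \<open>h\<^sup>-\<close> equal to \<open>0\<close> at index \<open>M + 1\<close>, and likewise in \<open>y\<close>.
\<close>

definition h_minus :: "mesh \<Rightarrow> nat \<Rightarrow> real" where
  "h_minus T i = mx T i - x_half T (i - 1)"

definition h_plus :: "mesh \<Rightarrow> nat \<Rightarrow> real" where
  "h_plus T i = x_half T i - mx T i"

definition k_minus :: "mesh \<Rightarrow> nat \<Rightarrow> real" where
  "k_minus T j = my T j - y_half T (j - 1)"

definition k_plus :: "mesh \<Rightarrow> nat \<Rightarrow> real" where
  "k_plus T j = y_half T j - my T j"

definition h_half :: "mesh \<Rightarrow> nat \<Rightarrow> real" where
  "h_half T i = mx T (i + 1) - mx T i"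

definition k_half :: "mesh \<Rightarrow> nat \<Rightarrow> real" where
  "k_half T j = my T (j + 1) - my T j"

definition norm_1 :: "mesh \<Rightarrow> (nat \<Rightarrow> nat \<Rightarrow> real) \<Rightarrow> real" where
  "norm_1 T w = sqrt (
     (\<Sum>i=0..mM T. \<Sum>j=0..mN T. mk T j * ((w (i + 1) j - w i j)\<^sup>2 / h_half T i)) +
     (\<Sum>i=0..mM T. \<Sum>j=0..mN T. mh T i * ((w i (j + 1) - w i j)\<^sup>2 / k_half T j)))"

definition norm_L2 :: "mesh \<Rightarrow> (nat \<Rightarrow> nat \<Rightarrow> real) \<Rightarrow> real" where
  "norm_L2 T w = sqrt (\<Sum>i=0..mM T. \<Sum>j=0..mN T. mh T i * mk T j * (w i j)\<^sup>2)"

definition diff_x :: "mesh \<Rightarrow> (nat \<Rightarrow> nat \<Rightarrow> real) \<Rightarrow> nat \<Rightarrow> nat \<Rightarrow> real" where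
  "diff_x T w i j = (w (i + 1) j - w i j) / h_half T i"

definition diff_y :: "mesh \<Rightarrow> (nat \<Rightarrow> nat \<Rightarrow> real) \<Rightarrow> nat \<Rightarrow> nat \<Rightarrow> real" where
  "diff_y T w i j = (w i (j + 1) - w i j) / k_half T j"

definition discrete_laplacian :: "mesh \<Rightarrow> (nat \<Rightarrow> nat \<Rightarrow> real) \<Rightarrow> nat \<Rightarrow> nat \<Rightarrow> real" where
  "discrete_laplacian T w i j =
     - mk T j * ((w (i + 1) j - w i j) / h_half T i - (w i j - w (i - 1) j) / h_half T (i - 1))
     - mh T i * ((w i (j + 1) - w i j) / k_half T j - (w i j - w i (j - 1)) / k_half T (j - 1))"

text \<open>
  The finite volume approximation of \<open>\<partial>\<^sub>x\<^sup>2 u\<close>. The two prescriptions at the four corners are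
  compatible: \<open>u = 0\<close> on the boundary forces \<open>f = - \<Delta>u = 0\<close> there.
\<close>

definition is_approx_uxx ::
  "mesh \<Rightarrow> (real \<times> real \<Rightarrow> real) \<Rightarrow> (nat \<Rightarrow> nat \<Rightarrow> real) \<Rightarrow> bool" where
  "is_approx_uxx T f v \<longleftrightarrow>
     (\<forall>i\<in>{0..mM T + 1}. v i 0 = 0 \<and> v i (mN T + 1) = 0) \<and>
     (\<forall>j\<in>{0..mN T + 1}. v 0 j = - f (0, my T j) \<and> v (mM T + 1) j = - f (1, my T j)) \<and>
     (\<forall>i\<in>{1..mM T}. \<forall>j\<in>{1..mN T}.
        discrete_laplacian T v i j = integral (cell T i j) (pdx (pdx f)))"

definition gamma_x :: "mesh \<Rightarrow> (nat \<Rightarrow> nat \<Rightarrow> real) \<Rightarrow> nat \<Rightarrow> nat \<Rightarrow> real" where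
  "gamma_x T v i j = - mk T j * ((h_minus T (i + 1) - h_plus T i) / 2) * v i j"

definition gamma_y ::
  "mesh \<Rightarrow> (real \<times> real \<Rightarrow> real) \<Rightarrow> (nat \<Rightarrow> nat \<Rightarrow> real) \<Rightarrow> nat \<Rightarrow> nat \<Rightarrow> real" where
  "gamma_y T f v i j =
     - mh T i * ((k_minus T (j + 1) - k_plus T j) / 2) * (- f (mx T i, y_half T j) - v i j)"

definition delta ::
  "mesh \<Rightarrow> (real \<times> real \<Rightarrow> real) \<Rightarrow> (nat \<Rightarrow> nat \<Rightarrow> real) \<Rightarrow> nat \<Rightarrow> nat \<Rightarrow> real" where
  "delta T f v i j =
       mh T i * ((k_plus T j)\<^sup>2 / 2) * diff_y T v i j
     - mh T i * ((k_minus T j)\<^sup>2 / 2) * diff_y T v i (j - 1)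
     + mk T j * ((h_plus T i)\<^sup>2 / 2) * (- pdx f (mx T i, my T j) - diff_x T v i j)
     - mk T j * ((h_minus T i)\<^sup>2 / 2) * (- pdx f (mx T (i - 1), my T j) - diff_x T v (i - 1) j)"

definition is_first_correction ::
  "mesh \<Rightarrow> (real \<times> real \<Rightarrow> real) \<Rightarrow> (nat \<Rightarrow> nat \<Rightarrow> real) \<Rightarrow> (nat \<Rightarrow> nat \<Rightarrow> real) \<Rightarrow> bool" where
  "is_first_correction T f v w \<longleftrightarrow>
     (\<forall>i\<in>{0..mM T + 1}. w i 0 = 0 \<and> w i (mN T + 1) = 0) \<and>
     (\<forall>j\<in>{0..mN T + 1}. w 0 j = 0 \<and> w (mM T + 1) j = 0) \<and>
     (\<forall>i\<in>{1..mM T}. \<forall>j\<in>{1..mN T}.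
        discrete_laplacian T w i j =
          integral (cell T i j) f
          + (gamma_x T v i j - gamma_x T v (i - 1) j)
          + (gamma_y T f v i j - gamma_y T f v i (j - 1))
          + delta T f v i j)"

definition grid_error ::
  "mesh \<Rightarrow> (real \<times> real \<Rightarrow> real) \<Rightarrow> (nat \<Rightarrow> nat \<Rightarrow> real) \<Rightarrow> nat \<Rightarrow> nat \<Rightarrow> real" where
  "grid_error T u w i j =
     (if i \<in> {1..mM T} \<and> j \<in> {1..mN T} then u (mx T i, my T j) - w i j else 0)"

end

theory Submission
  imports Defs
begin

text \<open>
  The scheme is a discrete divergence, so its error equation has the differences of flux errors as
  right-hand side, and testing it with the error itself shows that only the size of the flux errors
  matters (\<open>energy_estimate\<close>). This gains one power of the mesh size over a bound by the truncation
  error, in which the flux errors are divided by the cell widths.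

  The difference quotient of \<open>u\<close> across a cell edge approximates the mean normal derivative on that
  edge with an error whose leading part has two sources. As the edge is not halfway between the
  mesh points, there is a multiple of the second normal derivative at the edge; the term \<open>\<gamma>\<close>
  removes it. As the mesh point is not the centre of the cell, there is a multiple of the mixed
  derivative \<open>u\<^sub>x\<^sub>y\<close>. Its coefficient is of first order in the mesh size, too large to be left in the
  flux, but its difference over a cell is a multiple of \<open>u\<^sub>x\<^sub>x\<^sub>y\<close> or \<open>u\<^sub>x\<^sub>y\<^sub>y\<close>, which is what \<open>\<delta>\<close> removes.
  It therefore moves from the flux to the volume term. Everything else is of second order.

  The corrections involve \<open>u\<^sub>x\<^sub>x\<close> and its difference quotients, replaced by the computed values \<open>v\<close>;
  the second derivative \<open>u\<^sub>y\<^sub>y\<close> is recovered as \<open>- f - u\<^sub>x\<^sub>x\<close>. Now \<open>u\<^sub>x\<^sub>x\<close> solves a Dirichlet problem itself,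
  with right-hand side \<open>f\<^sub>x\<^sub>x\<close>: on the horizontal sides it vanishes, since \<open>u\<close> does, and on the vertical
  ones it equals \<open>- f\<close>. Hence \<open>v\<close> is the uncorrected scheme for \<open>u\<^sub>x\<^sub>x\<close>, and the same energy estimate
  bounds its error by the first power of the mesh size (\<open>uxx_error_bound\<close>). In \<open>\<gamma>\<close> and \<open>\<delta>\<close> this error
  is multiplied by another power of the mesh size. The discrete Poincare inequalities \<open>poincare_x\<close>
  and \<open>poincare_y\<close> control its values, and they reduce the two weighted \<open>L\<^sup>2\<close> bounds of the theorem
  to the energy bound.
\<close>

section \<open>Iterated partial derivatives on the closed square\<close>

lemma pdx_cong:
  assumes eq: "\<And>p. p \<in> Omega_bar \<Longrightarrow> g p = g' p" and "p \<in> Omega_bar"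
  shows "pdx g p = pdx g' p"
proof -
  obtain x y where p: "p = (x, y)" "x \<in> {0..1}" "y \<in> {0..1}"
    using assms(2) by (auto simp: Omega_bar_def)
  have "\<forall>\<^sub>F t in nhds x. t \<in> {0..1} \<longrightarrow> g (t, y) = g' (t, y)"
    using eq p by (intro always_eventually) (auto simp: Omega_bar_def)
  then show ?thesis
    using p by (auto simp: pdx_def intro: vector_derivative_cong_eq)
qed

lemma pdx_eqI:
  assumes "((\<lambda>t. g (t, y)) has_real_derivative d) (at x within {0..1})" "x \<in> {0..1}"
  shows "pdx g (x, y) = d"
  using assms
  by (simp add: pdx_def has_real_derivative_iff_has_vector_derivative
      vector_derivative_within_closed_interval)

lemma pdy_eqI:
  assumes "((\<lambda>t. g (x, t)) has_real_derivative d) (at y within {0..1})" "y \<in> {0..1}"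
  shows "pdy g (x, y) = d"
  using assms
  by (simp add: pdy_def has_real_derivative_iff_has_vector_derivative
      vector_derivative_within_closed_interval)

lemma has_pdx:
  assumes "has_partials g" "x \<in> {0..1}" "y \<in> {0..1}"
  shows "((\<lambda>t. g (t, y)) has_real_derivative pdx g (x, y)) (at x within {0..1})"
  using assms unfolding has_partials_def pdx_def
  by (simp add: has_real_derivative_iff_has_vector_derivative vector_derivative_works[symmetric])

lemma has_pdy:
  assumes "has_partials g" "x \<in> {0..1}" "y \<in> {0..1}"
  shows "((\<lambda>t. g (x, t)) has_real_derivative pdy g (x, y)) (at y within {0..1})"
  using assms unfolding has_partials_def pdy_def
  by (simp add: has_real_derivative_iff_has_vector_derivative vector_derivative_works[symmetric])

lemma C_bar_continuous: "C_bar n g \<Longrightarrow> continuous_on Omega_bar g"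
  by (cases n) auto

lemma C_bar_mono: "C_bar n g \<Longrightarrow> m \<le> n \<Longrightarrow> C_bar m g"
proof (induction n arbitrary: m g)
  case (Suc n)
  then show ?case
    by (cases m) (auto simp: C_bar_continuous)
qed simp

lemma C_bar_funpow_pdx: "C_bar (n + a) g \<Longrightarrow> C_bar n ((pdx ^^ a) g)"
  by (induction a arbitrary: n) (force dest: C_bar_mono simp flip: add_Suc)+

lemma C_bar_funpow_pdy: "C_bar (n + a) g \<Longrightarrow> C_bar n ((pdy ^^ a) g)"
  by (induction a arbitrary: n) (force dest: C_bar_mono simp flip: add_Suc)+

lemma continuous_on_slice_x:
  assumes "continuous_on Omega_bar g" "y \<in> {0..1}" "S \<subseteq> {0..1}"
  shows "continuous_on S (\<lambda>t. g (t, y))"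
  using assms by (intro continuous_on_compose2[OF assms(1)] continuous_intros)
    (auto simp: Omega_bar_def)

lemma continuous_on_slice_y:
  assumes "continuous_on Omega_bar g" "x \<in> {0..1}" "S \<subseteq> {0..1}"
  shows "continuous_on S (\<lambda>t. g (x, t))"
  using assms by (intro continuous_on_compose2[OF assms(1)] continuous_intros)
    (auto simp: Omega_bar_def)

lemma ftc_real:
  fixes g :: "real \<Rightarrow> real"
  assumes "\<And>t. t \<in> {0..1} \<Longrightarrow> (g has_real_derivative g' t) (at t within {0..1})"
    and "0 \<le> p" "p \<le> q" "q \<le> 1"
  shows "(g' has_integral (g q - g p)) {p..q}"
proof (rule fundamental_theorem_of_calculus)
  fix t assume t: "t \<in> {p..q}"
  then have "(g has_vector_derivative g' t) (at t within {0..1})"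
    using assms by (auto simp: has_real_derivative_iff_has_vector_derivative[symmetric])
  then show "(g has_vector_derivative g' t) (at t within {p..q})"
    by (rule has_vector_derivative_within_subset) (use assms in auto)
qed (use assms in auto)

text \<open>
  The mixed second derivatives agree up to the boundary: \<open>\<partial>\<^sub>x \<partial>\<^sub>y g\<close> integrated in \<open>y\<close> from the
  bottom edge gives the increment of \<open>\<partial>\<^sub>x g\<close>, by differentiation under the integral sign, and the
  fundamental theorem of calculus recovers it as \<open>\<partial>\<^sub>y \<partial>\<^sub>x g\<close>.
\<close>

lemma pdx_pdy_commute:
  assumes g: "C_bar 2 g" and p: "p \<in> Omega_bar"
  shows "pdx (pdy g) p = pdy (pdx g) p"
proof -
  define P where "P = pdx (pdy g)"
  have reg: "has_partials g" "has_partials (pdy g)" "continuous_on Omega_bar P"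
    "continuous_on Omega_bar (pdy g)"
    using g by (auto simp: numeral_2_eq_2 P_def)
  obtain x y where xy: "p = (x, y)" "x \<in> {0..1}" "y \<in> {0..1}"
    using p by (auto simp: Omega_bar_def)
  have incr: "pdx g (x, z) = pdx g (x, 0) + integral {0..z} (\<lambda>t. P (x, t))"
    if z: "z \<in> {0..1}" for z
  proof -
    have G: "integral {0..z} (\<lambda>t. pdy g (s, t)) = g (s, z) - g (s, 0)" if "s \<in> {0..1}" for s
      by (rule integral_unique, rule ftc_real) (use reg that z in \<open>auto intro!: has_pdy\<close>)
    have "((\<lambda>s. integral (cbox 0 z) (\<lambda>t. pdy g (s, t))) has_field_derivative
            integral (cbox 0 z) (\<lambda>t. P (x, t))) (at x within {0..1})"
    proof (rule leibniz_rule_field_derivative)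
      show "((\<lambda>s. pdy g (s, t)) has_field_derivative P (s, t)) (at s within {0..1})"
        if "s \<in> {0..1}" "t \<in> cbox 0 z" for s t
        using has_pdx[OF reg(2), of s t] that z by (auto simp: P_def)
      show "(\<lambda>t. pdy g (s, t)) integrable_on cbox 0 z" if "s \<in> {0..1}" for s
        unfolding cbox_interval using that z
        by (intro integrable_continuous_real continuous_on_slice_y[OF reg(4)]) auto
      show "continuous_on ({0..1} \<times> cbox 0 z) (\<lambda>(s, t). P (s, t))"
        using z by (auto intro!: continuous_on_subset[OF reg(3)] simp: Omega_bar_def)
    qed (use xy in auto)
    then have "((\<lambda>s. integral {0..z} (\<lambda>t. pdy g (s, t))) has_real_derivative
            integral {0..z} (\<lambda>t. P (x, t))) (at x within {0..1})"
      by simp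
    then have "((\<lambda>s. g (s, z) - g (s, 0)) has_real_derivative
            integral {0..z} (\<lambda>t. P (x, t))) (at x within {0..1})"
      by (rule has_field_derivative_transform_within[where d = 1]) (use xy G in auto)
    from DERIV_add[OF this has_pdx[OF reg(1), of x 0]] xy
    have "((\<lambda>s. g (s, z)) has_real_derivative
            integral {0..z} (\<lambda>t. P (x, t)) + pdx g (x, 0)) (at x within {0..1})"
      by simp
    from pdx_eqI[OF this] xy show ?thesis by simp
  qed
  have "((\<lambda>z. pdx g (x, 0) + integral {0..z} (\<lambda>t. P (x, t))) has_real_derivative 0 + P (x, y))
          (at y within {0..1})"
    by (intro DERIV_add DERIV_const integral_has_real_derivative continuous_on_slice_y reg)
      (use xy in auto)
  then have "((\<lambda>z. pdx g (x, z)) has_real_derivative 0 + P (x, y)) (at y within {0..1})"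
    by (rule has_field_derivative_transform_within[where d = 1])
       (use xy in \<open>auto simp: incr[symmetric]\<close>)
  from pdy_eqI[OF this] xy show ?thesis by (simp add: P_def)
qed

text \<open>
  The norm of the theorem only sees derivatives taken first in \<open>y\<close> and then in \<open>x\<close>; commuting
  \<open>\<partial>\<^sub>y\<close> past all the \<open>\<partial>\<^sub>x\<close> brings every derivative into that order.
\<close>

lemma pdy_funpow_pdx_commute:
  assumes "C_bar (Suc a) g" "p \<in> Omega_bar"
  shows "pdy ((pdx ^^ a) g) p = (pdx ^^ a) (pdy g) p"
  using assms
proof (induction a arbitrary: p)
  case (Suc a)
  have "C_bar 2 ((pdx ^^ a) g)"
    using Suc.prems(1) by (intro C_bar_funpow_pdx) simp
  then have "pdy (pdx ((pdx ^^ a) g)) p = pdx (pdy ((pdx ^^ a) g)) p"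
    using Suc.prems(2) by (simp add: pdx_pdy_commute)
  also have "\<dots> = pdx ((pdx ^^ a) (pdy g)) p"
    using Suc.prems C_bar_mono[OF Suc.prems(1), of "Suc a"]
    by (intro pdx_cong Suc.IH) auto
  finally show ?case by simp
qed simp

definition partial :: "(real \<times> real \<Rightarrow> real) \<Rightarrow> nat \<Rightarrow> nat \<Rightarrow> real \<times> real \<Rightarrow> real" where
  "partial g a b = (pdx ^^ a) ((pdy ^^ b) g)"

lemma partial_C_bar: "C_bar n g \<Longrightarrow> a + b + m \<le> n \<Longrightarrow> C_bar m (partial g a b)"
  unfolding partial_def
  by (intro C_bar_funpow_pdx C_bar_funpow_pdy) (erule C_bar_mono, simp)

lemma has_partial_x:
  assumes "C_bar n g" "a + b < n" "x \<in> {0..1}" "y \<in> {0..1}"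
  shows "((\<lambda>t. partial g a b (t, y)) has_real_derivative partial g (Suc a) b (x, y))
    (at x within {0..1})"
  using has_pdx[of "partial g a b" x y] partial_C_bar[of n g a b 1] assms
  by (simp add: partial_def)

lemma has_partial_y:
  assumes "C_bar n g" "a + b < n" "x \<in> {0..1}" "y \<in> {0..1}"
  shows "((\<lambda>t. partial g a b (x, t)) has_real_derivative partial g a (Suc b) (x, y))
    (at y within {0..1})"
proof -
  have "C_bar (Suc a) ((pdy ^^ b) g)"
    by (rule C_bar_funpow_pdy, rule C_bar_mono[OF assms(1)]) (use assms(2) in simp)
  then have "pdy (partial g a b) (x, y) = partial g a (Suc b) (x, y)"
    using assms pdy_funpow_pdx_commute[of a "(pdy ^^ b) g" "(x, y)"]
    by (simp add: partial_def Omega_bar_def)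
  then show ?thesis
    using has_pdy[of "partial g a b" x y] partial_C_bar[of n g a b 1] assms
    by simp
qed

lemma abs_partial_le_max_norm:
  assumes "C_bar n g" "a + b \<le> n" "p \<in> Omega_bar"
  shows "\<bar>partial g a b p\<bar> \<le> max_norm n g"
proof -
  have "compact ((\<lambda>p. \<bar>partial g a b p\<bar>) ` Omega_bar)"
    using partial_C_bar[OF assms(1), of a b 0] assms(2)
    by (intro compact_continuous_image continuous_intros)
       (auto simp: Omega_bar_def compact_Times)
  then have "bdd_above ((\<lambda>p. \<bar>partial g a b p\<bar>) ` Omega_bar)"
    by (intro bounded_imp_bdd_above compact_imp_bounded)
  then have "\<bar>partial g a b p\<bar> \<le> (SUP p\<in>Omega_bar. \<bar>partial g a b p\<bar>)"
    using assms(3) by (intro cSUP_upper) auto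
  also have "\<dots> \<le> max_norm n g"
    unfolding max_norm_def partial_def
  proof (rule Max_ge)
    have "finite ({..n} \<times> {..n})" by simp
    then have "finite {(a, b). a + b \<le> n}"
      by (rule finite_subset[rotated]) auto
    then show "finite ((\<lambda>(a, b). SUP p\<in>Omega_bar. \<bar>(pdx ^^ a) ((pdy ^^ b) g) p\<bar>) `
        {(a, b). a + b \<le> n})"
      by (rule finite_imageI)
  qed (use assms in force)
  finally show ?thesis .
qed

section \<open>Taylor estimates on the unit interval\<close>

lemma increment_bound:
  fixes g :: "real \<Rightarrow> real"
  assumes "\<And>t. t \<in> {0..1} \<Longrightarrow> (g has_real_derivative g' t) (at t within {0..1})"
    and "\<And>t. t \<in> {0..1} \<Longrightarrow> \<bar>g' t\<bar> \<le> B" and "s \<in> {0..1}" "t \<in> {0..1}"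
  shows "\<bar>g s - g t\<bar> \<le> B * \<bar>s - t\<bar>"
  using field_differentiable_bound[of "{0..1}" g g' B s t] assms by auto

text \<open>
  The mean value inequality for \<open>g - g'(t) id\<close>. Taylor's formula would give half the constant.
\<close>

lemma tangent_bound:
  fixes g :: "real \<Rightarrow> real"
  assumes g: "\<And>t. t \<in> {0..1} \<Longrightarrow> (g has_real_derivative g' t) (at t within {0..1})"
    and g': "\<And>t. t \<in> {0..1} \<Longrightarrow> (g' has_real_derivative g'' t) (at t within {0..1})"
    and B: "\<And>t. t \<in> {0..1} \<Longrightarrow> \<bar>g'' t\<bar> \<le> B" and st: "s \<in> {0..1}" "t \<in> {0..1}"
  shows "\<bar>g s - (g t + g' t * (s - t))\<bar> \<le> B * (s - t)\<^sup>2"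
proof -
  let ?S = "closed_segment t s"
  have sub: "?S \<subseteq> {0..1}"
    using st by (auto simp: closed_segment_eq_real_ivl split: if_splits)
  have B0: "0 \<le> B" using B[of 0] by simp
  have "norm ((g s - g' t * s) - (g t - g' t * t)) \<le> (B * \<bar>s - t\<bar>) * norm (s - t)"
  proof (rule field_differentiable_bound[of ?S _ "\<lambda>z. g' z - g' t"])
    fix z assume z: "z \<in> ?S"
    then have z01: "z \<in> {0..1}" using sub by auto
    have "((\<lambda>z. g z - g' t * z) has_real_derivative g' z - g' t * 1) (at z within {0..1})"
      by (intro DERIV_diff g z01 DERIV_cmult DERIV_ident)
    then show "((\<lambda>z. g z - g' t * z) has_real_derivative g' z - g' t) (at z within ?S)"
      using sub by (auto intro: DERIV_subset)
    have "\<bar>g' z - g' t\<bar> \<le> B * \<bar>z - t\<bar>"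
      by (rule increment_bound[OF g' B]) (use z01 st in auto)
    also have "\<dots> \<le> B * \<bar>s - t\<bar>"
      using z B0 by (intro mult_left_mono) (auto simp: closed_segment_eq_real_ivl split: if_splits)
    finally show "norm (g' z - g' t) \<le> B * \<bar>s - t\<bar>" by simp
  qed auto
  then show ?thesis
    by (simp add: algebra_simps power2_eq_square abs_mult_self_eq flip: abs_mult)
qed

text \<open>Exact integration of an affine approximation; every quadrature error below comes from it.\<close>

lemma integral_affine_bound:
  fixes g :: "real \<Rightarrow> real"
  assumes "p \<le> q" "continuous_on {p..q} g"
    and "\<And>t. t \<in> {p..q} \<Longrightarrow> \<bar>g t - (c0 + c1 * (t - m))\<bar> \<le> E"
  shows "\<bar>integral {p..q} g - ((q - p) * c0 + ((q - m)\<^sup>2 - (m - p)\<^sup>2) / 2 * c1)\<bar> \<le> (q - p) * E"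
proof -
  have aff: "((\<lambda>t. c0 + c1 * (t - m)) has_integral
      (c0 * q + c1 * (q - m)\<^sup>2 / 2) - (c0 * p + c1 * (p - m)\<^sup>2 / 2)) {p..q}"
    by (rule fundamental_theorem_of_calculus)
       (auto intro!: derivative_eq_intros assms(1) simp flip: has_real_derivative_iff_has_vector_derivative)
  have "((\<lambda>t. g t - (c0 + c1 * (t - m))) has_integral integral {p..q} g -
      ((c0 * q + c1 * (q - m)\<^sup>2 / 2) - (c0 * p + c1 * (p - m)\<^sup>2 / 2))) {p..q}"
    by (intro has_integral_diff aff integrable_integral integrable_continuous_real assms)
  moreover have "0 \<le> E" using assms(3)[of p] assms(1) by simp
  ultimately have "norm (integral {p..q} g -
      ((c0 * q + c1 * (q - m)\<^sup>2 / 2) - (c0 * p + c1 * (p - m)\<^sup>2 / 2))) \<le> E * measure lborel {p..q}"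
    using assms(3) by (intro has_integral_bound_real[where S = "{}"]) auto
  then show ?thesis
    using assms(1) by (simp add: field_simps power2_eq_square)
qed

lemma quadrature_first_order:
  fixes g :: "real \<Rightarrow> real"
  assumes g: "\<And>t. t \<in> {0..1} \<Longrightarrow> (g has_real_derivative g' t) (at t within {0..1})"
    and B: "\<And>t. t \<in> {0..1} \<Longrightarrow> \<bar>g' t\<bar> \<le> B"
    and m: "0 \<le> p" "p \<le> m" "m \<le> q" "q \<le> 1" "m - p \<le> h" "q - m \<le> h"
  shows "\<bar>integral {p..q} g - (q - p) * g m\<bar> \<le> (q - p) * (B * h)"
proof -
  have B0: "0 \<le> B" using B[of 0] by simp
  have "\<bar>integral {p..q} g - ((q - p) * g m + ((q - m)\<^sup>2 - (m - p)\<^sup>2) / 2 * 0)\<bar> \<le> (q - p) * (B * h)"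
  proof (rule integral_affine_bound)
    show "continuous_on {p..q} g"
      using m by (intro continuous_on_subset[OF DERIV_continuous_on[OF g]]) auto
    fix t assume t: "t \<in> {p..q}"
    have "\<bar>g t - g m\<bar> \<le> B * \<bar>t - m\<bar>"
      by (rule increment_bound[OF g B]) (use m t in auto)
    also have "\<dots> \<le> B * h" using t m B0 by (intro mult_left_mono) auto
    finally show "\<bar>g t - (g m + 0 * (t - m))\<bar> \<le> B * h" by simp
  qed (use m in auto)
  then show ?thesis by simp
qed

lemma quadrature_second_order:
  fixes g :: "real \<Rightarrow> real"
  assumes g: "\<And>t. t \<in> {0..1} \<Longrightarrow> (g has_real_derivative g' t) (at t within {0..1})"
    and g': "\<And>t. t \<in> {0..1} \<Longrightarrow> (g' has_real_derivative g'' t) (at t within {0..1})"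
    and B: "\<And>t. t \<in> {0..1} \<Longrightarrow> \<bar>g'' t\<bar> \<le> B"
    and m: "0 \<le> p" "p \<le> m" "m \<le> q" "q \<le> 1" "m - p \<le> h" "q - m \<le> h"
  shows "\<bar>integral {p..q} g - ((q - p) * g m + ((q - m)\<^sup>2 - (m - p)\<^sup>2) / 2 * g' m)\<bar>
    \<le> (q - p) * (B * h\<^sup>2)"
proof (rule integral_affine_bound)
  have B0: "0 \<le> B" using B[of 0] by simp
  show "continuous_on {p..q} g"
    using m by (intro continuous_on_subset[OF DERIV_continuous_on[OF g]]) auto
  fix t assume t: "t \<in> {p..q}"
  have "\<bar>g t - (g m + g' m * (t - m))\<bar> \<le> B * (t - m)\<^sup>2"
    by (rule tangent_bound[OF g g' B]) (use m t in auto)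
  also have "\<dots> \<le> B * h\<^sup>2"
    using t m B0 by (intro mult_left_mono power2_le_iff_abs_le[THEN iffD2]) auto
  finally show "\<bar>g t - (g m + g' m * (t - m))\<bar> \<le> B * h\<^sup>2" .
qed (use m in auto)

text \<open>
  A difference of values is the integral of the derivative, so the estimates for difference
  quotients are quadrature estimates one derivative higher.
\<close>

lemma difference_first_order:
  fixes g :: "real \<Rightarrow> real"
  assumes g: "\<And>t. t \<in> {0..1} \<Longrightarrow> (g has_real_derivative g' t) (at t within {0..1})"
    and g': "\<And>t. t \<in> {0..1} \<Longrightarrow> (g' has_real_derivative g'' t) (at t within {0..1})"
    and B: "\<And>t. t \<in> {0..1} \<Longrightarrow> \<bar>g'' t\<bar> \<le> B"
    and m: "0 \<le> p" "p \<le> m" "m \<le> q" "q \<le> 1" "m - p \<le> h" "q - m \<le> h"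
  shows "\<bar>g q - g p - (q - p) * g' m\<bar> \<le> (q - p) * (B * h)"
proof -
  have "integral {p..q} g' = g q - g p"
    by (rule integral_unique, rule ftc_real[OF g]) (use m in auto)
  then show ?thesis using quadrature_first_order[OF g' B m] by simp
qed

lemma difference_second_order:
  fixes g :: "real \<Rightarrow> real"
  assumes g: "\<And>t. t \<in> {0..1} \<Longrightarrow> (g has_real_derivative g' t) (at t within {0..1})"
    and g': "\<And>t. t \<in> {0..1} \<Longrightarrow> (g' has_real_derivative g'' t) (at t within {0..1})"
    and g'': "\<And>t. t \<in> {0..1} \<Longrightarrow> (g'' has_real_derivative g''' t) (at t within {0..1})"
    and B: "\<And>t. t \<in> {0..1} \<Longrightarrow> \<bar>g''' t\<bar> \<le> B"
    and m: "0 \<le> p" "p \<le> m" "m \<le> q" "q \<le> 1" "m - p \<le> h" "q - m \<le> h"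
  shows "\<bar>g q - g p - ((q - p) * g' m + ((q - m)\<^sup>2 - (m - p)\<^sup>2) / 2 * g'' m)\<bar>
    \<le> (q - p) * (B * h\<^sup>2)"
proof -
  have "integral {p..q} g' = g q - g p"
    by (rule integral_unique, rule ftc_real[OF g]) (use m in auto)
  then show ?thesis using quadrature_second_order[OF g' g'' B m] by simp
qed

section \<open>One-dimensional grids\<close>

text \<open>
  One coordinate direction of a mesh, used for both: cells \<open>[edge (i - 1), edge i]\<close> of width \<open>w i\<close>
  at most \<open>H\<close>, with the mesh point \<open>p i\<close> inside; \<open>p 0\<close> and \<open>p (n + 1)\<close> are the end points of the
  unit interval.
\<close>

locale grid =
  fixes n :: nat and w p edge :: "nat \<Rightarrow> real" and H :: real
  assumes n_pos: "0 < n"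
    and w_0: "w 0 = 0"
    and w_pos: "i \<in> {1..n} \<Longrightarrow> 0 < w i"
    and w_le: "i \<in> {1..n} \<Longrightarrow> w i \<le> H"
    and edge_0: "edge 0 = 0"
    and edge_Suc: "edge (Suc i) = edge i + w (Suc i)"
    and edge_n: "edge n = 1"
    and p_0: "p 0 = 0"
    and p_end: "p (Suc n) = 1"
    and edge_less_point: "i < n \<Longrightarrow> edge i < p (Suc i)"
    and point_less_edge: "i \<in> {1..n} \<Longrightarrow> p i < edge i"
begin

lemma H_pos: "0 < H"
  using w_pos[of 1] w_le[of 1] n_pos by force

lemma w_nonneg: "i \<le> n \<Longrightarrow> 0 \<le> w i"
  using w_pos[of i] w_0 by (cases i) auto

lemma point_le_edge: "i \<le> n \<Longrightarrow> p i \<le> edge i"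
  using point_less_edge[of i] p_0 edge_0 by (cases i) auto

lemma edge_le_point: "i \<le> n \<Longrightarrow> edge i \<le> p (Suc i)"
  using edge_less_point[of i] p_end edge_n by (cases "i = n") auto

lemma gap_pos: "i \<le> n \<Longrightarrow> 0 < p (Suc i) - p i"
  using edge_less_point[of 0] point_less_edge[of i] edge_le_point[of i] p_0 edge_0 n_pos
  by (cases i) auto

lemma edge_mono: "i \<le> j \<Longrightarrow> j \<le> n \<Longrightarrow> edge i \<le> edge j"
proof (induction j)
  case (Suc j)
  then show ?case
    using w_pos[of "Suc j"] by (cases "i = Suc j") (auto simp: edge_Suc)
qed simp

lemma edge_unit: "i \<le> n \<Longrightarrow> edge i \<in> {0..1}"
  using edge_mono[of 0 i] edge_mono[of i n] by (auto simp: edge_0 edge_n)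

lemma point_unit: "i \<le> Suc n \<Longrightarrow> p i \<in> {0..1}"
proof (cases i)
  case (Suc j)
  assume "i \<le> Suc n"
  then have "edge j \<le> p i" "i = Suc n \<or> p i \<le> edge i"
    using edge_le_point[of j] point_le_edge[of i] Suc by (auto simp: le_Suc_eq)
  then show ?thesis
    using edge_unit[of j] edge_unit[of i] p_end \<open>i \<le> Suc n\<close> Suc
    by (cases "i = Suc n") auto
qed (simp add: p_0)

lemma left_le: "i \<le> n \<Longrightarrow> p (Suc i) - edge i \<le> H"
  using point_less_edge[of "Suc i"] w_le[of "Suc i"] edge_Suc[of i] p_end edge_n H_pos
  by (cases "i = n") auto

lemma right_le: "i \<le> n \<Longrightarrow> edge i - p i \<le> H"
proof (cases i)
  case (Suc j)
  assume "i \<le> n"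
  then show ?thesis
    using edge_less_point[of j] w_le[of i] edge_Suc[of j] Suc by simp
qed (use H_pos edge_0 p_0 in simp)

lemma gap_le: "i \<le> n \<Longrightarrow> p (Suc i) - p i \<le> 2 * H"
  using left_le[of i] right_le[of i] by simp

lemma sum_gap: "(\<Sum>i=0..n. p (Suc i) - p i) = 1"
  using sum_lessThan_telescope[of p "Suc n"]
  by (simp add: p_0 p_end lessThan_Suc_atMost atLeast0AtMost del: sum.lessThan_Suc)

lemma sum_w: "(\<Sum>i=0..n. w i) = 1"
proof -
  have "(\<Sum>i=0..m. w i) = edge m" for m
    by (induction m) (auto simp: w_0 edge_0 edge_Suc)
  then show ?thesis by (simp add: edge_n)
qed

lemma sum_w_Suc: "(\<Sum>i=1..n. w i) = 1"
  using sum_w by (simp add: sum.atLeast_Suc_atMost w_0)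

text \<open>
  A grid function that vanishes at the left end is bounded pointwise by its difference quotients:
  the increments add up to its value, and Cauchy--Schwarz applies with the gaps, whose sum is at
  most the length of the interval.
\<close>

lemma poincare_pointwise:
  fixes e :: "nat \<Rightarrow> real"
  assumes e0: "e 0 = 0" and i: "i \<le> Suc n"
  shows "(e i)\<^sup>2 \<le> (\<Sum>l=0..n. (e (Suc l) - e l)\<^sup>2 / (p (Suc l) - p l))"
proof -
  let ?g = "\<lambda>l. p (Suc l) - p l" and ?d = "\<lambda>l. e (Suc l) - e l"
  have pos: "0 < ?g l" if "l < i" for l
    using gap_pos[of l] that i by simp
  have "e i = (\<Sum>l<i. ?d l)"
    using sum_lessThan_telescope[of e i] e0 by simp
  also have "\<dots> = (\<Sum>l<i. sqrt (?g l) * (?d l / sqrt (?g l)))"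
    by (intro sum.cong) (use pos in force)+
  finally have "(e i)\<^sup>2 \<le> (\<Sum>l<i. (sqrt (?g l))\<^sup>2) * (\<Sum>l<i. (?d l / sqrt (?g l))\<^sup>2)"
    by (simp only: Cauchy_Schwarz_ineq_sum)
  also have "\<dots> = (\<Sum>l<i. ?g l) * (\<Sum>l<i. (?d l)\<^sup>2 / ?g l)"
    using pos by (intro arg_cong2[where f = "(*)"] sum.cong) (auto simp: power_divide less_imp_le)
  also have "\<dots> = p i * (\<Sum>l<i. (?d l)\<^sup>2 / ?g l)"
    using sum_lessThan_telescope[of p i] by (simp add: p_0)
  also have "\<dots> \<le> 1 * (\<Sum>l<i. (?d l)\<^sup>2 / ?g l)"
    using point_unit[OF i] pos by (intro mult_right_mono sum_nonneg) (auto simp: less_imp_le)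
  also have "\<dots> \<le> 1 * (\<Sum>l=0..n. (?d l)\<^sup>2 / ?g l)"
    using gap_pos i by (intro mult_left_mono sum_mono2) (auto simp: less_imp_le)
  finally show ?thesis by simp
qed

lemma poincare_weighted:
  fixes e a :: "nat \<Rightarrow> real"
  assumes "e 0 = 0" "\<And>i. i \<le> n \<Longrightarrow> 0 \<le> a i" "(\<Sum>i=0..n. a i) = 1"
  shows "(\<Sum>i=0..n. a i * (e i)\<^sup>2) \<le> (\<Sum>l=0..n. (e (Suc l) - e l)\<^sup>2 / (p (Suc l) - p l))"
    (is "_ \<le> ?R")
proof -
  have "(\<Sum>i=0..n. a i * (e i)\<^sup>2) \<le> (\<Sum>i=0..n. a i * ?R)"
    using assms by (intro sum_mono mult_left_mono poincare_pointwise) auto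
  also have "\<dots> = ?R" using assms(3) by (simp flip: sum_distrib_right)
  finally show ?thesis .
qed

end

lemma summation_by_parts:
  fixes q e :: "nat \<Rightarrow> real"
  assumes "e 0 = 0" "e (Suc n) = 0"
  shows "(\<Sum>i=1..n. - (q i - q (i - 1)) * e i) = (\<Sum>i=0..n. q i * (e (Suc i) - e i))"
proof -
  have "(\<Sum>i=1..n. - (q i - q (i - 1)) * e i) =
      (\<Sum>i=0..n. q i * (e (Suc i) - e i)) - q n * e (Suc n) + q 0 * e 0" for n
    by (induction n) (auto simp: algebra_simps)
  then show ?thesis using assms by simp
qed

section \<open>Energy estimates on a mesh\<close>

text \<open>
  The flux \<open>a\<close>, of size \<open>b\<close> per unit length \<open>c\<close> of its edge, against an increment \<open>d\<close> over the
  distance \<open>t\<close>: a quarter of the energy contributed by \<open>d\<close> is enough to absorb the product.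
\<close>

lemma young:
  fixes a b d t :: real
  assumes "\<bar>a\<bar> \<le> c * b" "0 < t" "0 \<le> c"
  shows "a * d \<le> c * t * b\<^sup>2 + c * (d\<^sup>2 / t) / 4"
proof -
  have "a * d \<le> \<bar>a\<bar> * \<bar>d\<bar>" by (metis abs_ge_self abs_mult)
  also have "\<dots> \<le> (c * b) * \<bar>d\<bar>" using assms by (intro mult_right_mono) auto
  also have "b * \<bar>d\<bar> \<le> t * b\<^sup>2 + (d\<^sup>2 / t) / 4"
  proof -
    have "0 \<le> (2 * t * b - \<bar>d\<bar>)\<^sup>2" by simp
    also have "(2 * t * b - \<bar>d\<bar>)\<^sup>2 = 4 * t * ((t * b\<^sup>2 + (d\<^sup>2 / t) / 4) - b * \<bar>d\<bar>)"
      using assms(2) by (simp add: field_simps power2_eq_square)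
    finally show ?thesis using assms(2) by (simp add: zero_le_mult_iff)
  qed
  then have "(c * b) * \<bar>d\<bar> \<le> c * (t * b\<^sup>2 + (d\<^sup>2 / t) / 4)"
    using assms(3) by (simp add: mult.assoc mult_left_mono)
  finally show ?thesis by (simp add: algebra_simps)
qed

locale admissible =
  fixes T :: mesh
  assumes admissible: "admissible_mesh T"
begin

abbreviation "M \<equiv> mM T"
abbreviation "N \<equiv> mN T"
abbreviation "H \<equiv> mesh_size T"

lemma widths_le: "i \<in> {1..M} \<Longrightarrow> mh T i \<le> H" "j \<in> {1..N} \<Longrightarrow> mk T j \<le> H"
  unfolding mesh_size_def by (auto intro!: Max_ge)

sublocale x: grid M "mh T" "mx T" "x_half T" H
proof
  show "x_half T i < mx T (Suc i)" if "i < M" for i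
    using admissible that by (auto simp: admissible_mesh_def Ball_def dest!: spec[of _ "Suc i"])
qed (use admissible widths_le in \<open>auto simp: admissible_mesh_def x_half_def\<close>)

sublocale y: grid N "mk T" "my T" "y_half T" H
proof
  show "y_half T i < my T (Suc i)" if "i < N" for i
    using admissible that by (auto simp: admissible_mesh_def Ball_def dest!: spec[of _ "Suc i"])
qed (use admissible widths_le in \<open>auto simp: admissible_mesh_def y_half_def\<close>)

definition zero_trace :: "(nat \<Rightarrow> nat \<Rightarrow> real) \<Rightarrow> bool" where
  "zero_trace e \<longleftrightarrow> (\<forall>i\<le>Suc M. e i 0 = 0 \<and> e i (Suc N) = 0) \<and>
     (\<forall>j\<le>Suc N. e 0 j = 0 \<and> e (Suc M) j = 0)"

definition energy_x :: "(nat \<Rightarrow> nat \<Rightarrow> real) \<Rightarrow> real" where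
  "energy_x e = (\<Sum>i=0..M. \<Sum>j=0..N. mk T j * ((e (Suc i) j - e i j)\<^sup>2 / h_half T i))"

definition energy_y :: "(nat \<Rightarrow> nat \<Rightarrow> real) \<Rightarrow> real" where
  "energy_y e = (\<Sum>i=0..M. \<Sum>j=0..N. mh T i * ((e i (Suc j) - e i j)\<^sup>2 / k_half T j))"

lemma h_half_pos: "i \<le> M \<Longrightarrow> 0 < h_half T i"
  using x.gap_pos by (simp add: h_half_def)

lemma k_half_pos: "j \<le> N \<Longrightarrow> 0 < k_half T j"
  using y.gap_pos by (simp add: k_half_def)

lemma energy_x_nonneg: "0 \<le> energy_x e"
  unfolding energy_x_def using h_half_pos y.w_nonneg
  by (auto intro!: sum_nonneg mult_nonneg_nonneg divide_nonneg_pos)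

lemma energy_y_nonneg: "0 \<le> energy_y e"
  unfolding energy_y_def using k_half_pos x.w_nonneg
  by (auto intro!: sum_nonneg mult_nonneg_nonneg divide_nonneg_pos)

lemma norm_1_eq: "norm_1 T e = sqrt (energy_x e + energy_y e)"
  by (simp add: norm_1_def energy_x_def energy_y_def)

text \<open>
  The pointwise bound is uniform along a grid line, so any weights of total one serve in that
  direction: the cell widths as well as the distances of the mesh points, both of which are needed.
\<close>

lemma poincare_x:
  assumes e: "zero_trace e" and a: "\<And>i. i \<le> M \<Longrightarrow> 0 \<le> a i" "(\<Sum>i=0..M. a i) = 1"
  shows "(\<Sum>i=0..M. \<Sum>j=0..N. mk T j * a i * (e i j)\<^sup>2) \<le> energy_x e"
proof -
  have "(\<Sum>i=0..M. \<Sum>j=0..N. mk T j * a i * (e i j)\<^sup>2)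
      = (\<Sum>j=0..N. mk T j * (\<Sum>i=0..M. a i * (e i j)\<^sup>2))"
    by (subst sum.swap) (simp add: sum_distrib_left mult.assoc)
  also have "\<dots> \<le> (\<Sum>j=0..N. mk T j * (\<Sum>i=0..M. (e (Suc i) j - e i j)\<^sup>2 / h_half T i))"
    using e y.w_nonneg a unfolding h_half_def zero_trace_def add.commute[of _ 1] plus_1_eq_Suc
    by (intro sum_mono mult_left_mono x.poincare_weighted) auto
  also have "\<dots> = energy_x e"
    unfolding energy_x_def by (subst sum.swap) (simp add: sum_distrib_left)
  finally show ?thesis .
qed

lemma poincare_y:
  assumes e: "zero_trace e" and a: "\<And>j. j \<le> N \<Longrightarrow> 0 \<le> a j" "(\<Sum>j=0..N. a j) = 1"
  shows "(\<Sum>i=0..M. \<Sum>j=0..N. mh T i * a j * (e i j)\<^sup>2) \<le> energy_y e"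
proof -
  have "(\<Sum>i=0..M. \<Sum>j=0..N. mh T i * a j * (e i j)\<^sup>2)
      = (\<Sum>i=0..M. mh T i * (\<Sum>j=0..N. a j * (e i j)\<^sup>2))"
    by (simp add: sum_distrib_left mult.assoc)
  also have "\<dots> \<le> (\<Sum>i=0..M. mh T i * (\<Sum>j=0..N. (e i (Suc j) - e i j)\<^sup>2 / k_half T j))"
    using e x.w_nonneg a unfolding k_half_def zero_trace_def add.commute[of _ 1] plus_1_eq_Suc
    by (intro sum_mono mult_left_mono y.poincare_weighted) auto
  also have "\<dots> = energy_y e"
    unfolding energy_y_def by (simp add: sum_distrib_left)
  finally show ?thesis .
qed

lemma sum_h_half: "(\<Sum>i=0..M. h_half T i) = 1"
  using x.sum_gap by (simp add: h_half_def)

lemma sum_k_half: "(\<Sum>j=0..N. k_half T j) = 1"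
  using y.sum_gap by (simp add: k_half_def)

text \<open>
  Summation by parts along every grid line. With \<open>Ax\<close>, \<open>Ay\<close> the fluxes of \<open>e\<close> itself, the right-hand side
  is the energy of \<open>e\<close>.
\<close>

lemma discrete_divergence:
  assumes e: "zero_trace e"
  shows "(\<Sum>i=1..M. \<Sum>j=1..N.
        (- (Ax i j - Ax (i - 1) j) - (Ay i j - Ay i (j - 1))) * e i j) =
      (\<Sum>i=0..M. \<Sum>j=1..N. Ax i j * (e (Suc i) j - e i j)) +
      (\<Sum>i=1..M. \<Sum>j=0..N. Ay i j * (e i (Suc j) - e i j))"
proof -
  have "(\<Sum>i=1..M. \<Sum>j=1..N.
        (- (Ax i j - Ax (i - 1) j) - (Ay i j - Ay i (j - 1))) * e i j) =
      (\<Sum>i=1..M. \<Sum>j=1..N. - (Ax i j - Ax (i - 1) j) * e i j) +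
      (\<Sum>i=1..M. \<Sum>j=1..N. - (Ay i j - Ay i (j - 1)) * e i j)"
    by (simp only: sum.distrib[symmetric]) (simp add: algebra_simps)
  also have "(\<Sum>i=1..M. \<Sum>j=1..N. - (Ax i j - Ax (i - 1) j) * e i j)
      = (\<Sum>j=1..N. \<Sum>i=0..M. Ax i j * (e (Suc i) j - e i j))"
    by (subst sum.swap, intro sum.cong refl summation_by_parts)
       (use e in \<open>auto simp: zero_trace_def\<close>)
  also have "\<dots> = (\<Sum>i=0..M. \<Sum>j=1..N. Ax i j * (e (Suc i) j - e i j))"
    by (rule sum.swap)
  also have "(\<Sum>i=1..M. \<Sum>j=1..N. - (Ay i j - Ay i (j - 1)) * e i j)
      = (\<Sum>i=1..M. \<Sum>j=0..N. Ay i j * (e i (Suc j) - e i j))"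
    by (intro sum.cong refl summation_by_parts) (use e in \<open>auto simp: zero_trace_def\<close>)
  finally show ?thesis .
qed

lemma discrete_laplacian_flux_form:
  "discrete_laplacian T e i j =
    - (mk T j * ((e (Suc i) j - e i j) / h_half T i)
       - mk T j * ((e i j - e (i - 1) j) / h_half T (i - 1)))
    - (mh T i * ((e i (Suc j) - e i j) / k_half T j)
       - mh T i * ((e i j - e i (j - 1)) / k_half T (j - 1)))"
proof -
  have "- k * (a - b) - h * (c - d) = - (k * a - k * b) - (h * c - h * d)"
    for k h a b c d :: real
    by (simp add: algebra_simps)
  then show ?thesis by (simp add: discrete_laplacian_def)
qed

text \<open>
  Stability of the scheme: a right-hand side in divergence form is measured by its fluxes alone.
  Testing the equation with \<open>e\<close> itself, summation by parts turns fluxes into products with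
  differences of \<open>e\<close>; Young's inequality leaves at most half of the energy on the right.
\<close>

lemma energy_estimate:
  assumes e: "zero_trace e"
    and eq: "\<And>i j. i \<in> {1..M} \<Longrightarrow> j \<in> {1..N} \<Longrightarrow> discrete_laplacian T e i j =
        - (Gx i j - Gx (i - 1) j) - (Gy i j - Gy i (j - 1)) + S i j"
    and Gx: "\<And>i j. i \<le> M \<Longrightarrow> j \<in> {1..N} \<Longrightarrow> \<bar>Gx i j\<bar> \<le> mk T j * gx i j"
    and Gy: "\<And>i j. i \<in> {1..M} \<Longrightarrow> j \<le> N \<Longrightarrow> \<bar>Gy i j\<bar> \<le> mh T i * gy i j"
    and S: "\<And>i j. i \<in> {1..M} \<Longrightarrow> j \<in> {1..N} \<Longrightarrow> \<bar>S i j\<bar> \<le> mh T i * mk T j * s i j"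
  shows "energy_x e + energy_y e \<le> 2 * (
      (\<Sum>i=0..M. \<Sum>j=1..N. mk T j * h_half T i * (gx i j)\<^sup>2) +
      (\<Sum>i=1..M. \<Sum>j=0..N. mh T i * k_half T j * (gy i j)\<^sup>2) +
      (\<Sum>i=1..M. \<Sum>j=1..N. mh T i * mk T j * (s i j)\<^sup>2))" (is "_ \<le> 2 * (?X + ?Y + ?Z)")
proof -
  let ?dx = "\<lambda>i j. e (Suc i) j - e i j" and ?dy = "\<lambda>i j. e i (Suc j) - e i j"
  have ex: "(\<Sum>i=0..M. \<Sum>j=1..N. mk T j * ((?dx i j)\<^sup>2 / h_half T i)) = energy_x e"
    unfolding energy_x_def by (rule sum.cong[OF refl]) (simp add: sum.atLeast_Suc_atMost[of 0 N] y.w_0)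
  have ey: "(\<Sum>i=1..M. \<Sum>j=0..N. mh T i * ((?dy i j)\<^sup>2 / k_half T j)) = energy_y e"
    unfolding energy_y_def by (simp add: sum.atLeast_Suc_atMost[of 0 M] x.w_0)
  have "energy_x e + energy_y e =
      (\<Sum>i=0..M. \<Sum>j=1..N. (mk T j * (?dx i j / h_half T i)) * ?dx i j) +
      (\<Sum>i=1..M. \<Sum>j=0..N. (mh T i * (?dy i j / k_half T j)) * ?dy i j)"
    unfolding ex[symmetric] ey[symmetric] by (simp add: power2_eq_square mult.assoc)
  also have "\<dots> = (\<Sum>i=1..M. \<Sum>j=1..N. discrete_laplacian T e i j * e i j)"
    by (subst discrete_divergence[OF e, symmetric], intro sum.cong refl)
       (simp add: discrete_laplacian_flux_form)
  also have "\<dots> = (\<Sum>i=1..M. \<Sum>j=1..N.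
      (- (Gx i j - Gx (i - 1) j) - (Gy i j - Gy i (j - 1))) * e i j) +
      (\<Sum>i=1..M. \<Sum>j=1..N. S i j * e i j)"
    unfolding sum.distrib[symmetric]
  proof (intro sum.cong refl)
    fix i j assume "i \<in> {1..M}" "j \<in> {1..N}"
    from eq[OF this] show "discrete_laplacian T e i j * e i j =
        (- (Gx i j - Gx (i - 1) j) - (Gy i j - Gy i (j - 1))) * e i j + S i j * e i j"
      by (simp only: distrib_right)
  qed
  also have "(\<Sum>i=1..M. \<Sum>j=1..N.
      (- (Gx i j - Gx (i - 1) j) - (Gy i j - Gy i (j - 1))) * e i j) =
      (\<Sum>i=0..M. \<Sum>j=1..N. Gx i j * ?dx i j) + (\<Sum>i=1..M. \<Sum>j=0..N. Gy i j * ?dy i j)"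
    by (rule discrete_divergence[OF e])
  finally have tested: "energy_x e + energy_y e =
      (\<Sum>i=0..M. \<Sum>j=1..N. Gx i j * ?dx i j) + (\<Sum>i=1..M. \<Sum>j=0..N. Gy i j * ?dy i j)
      + (\<Sum>i=1..M. \<Sum>j=1..N. S i j * e i j)" .
  have "(\<Sum>i=0..M. \<Sum>j=1..N. Gx i j * ?dx i j) \<le>
      (\<Sum>i=0..M. \<Sum>j=1..N. mk T j * h_half T i * (gx i j)\<^sup>2 +
          mk T j * ((?dx i j)\<^sup>2 / h_half T i) / 4)"
    using Gx h_half_pos y.w_nonneg by (intro sum_mono young) auto
  also have "\<dots> = ?X + energy_x e / 4"
    unfolding ex[symmetric] by (simp only: sum.distrib sum_divide_distrib)
  finally have bx: "(\<Sum>i=0..M. \<Sum>j=1..N. Gx i j * ?dx i j) \<le> ?X + energy_x e / 4" .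
  have "(\<Sum>i=1..M. \<Sum>j=0..N. Gy i j * ?dy i j) \<le>
      (\<Sum>i=1..M. \<Sum>j=0..N. mh T i * k_half T j * (gy i j)\<^sup>2 +
          mh T i * ((?dy i j)\<^sup>2 / k_half T j) / 4)"
    using Gy k_half_pos x.w_nonneg by (intro sum_mono young) auto
  also have "\<dots> = ?Y + energy_y e / 4"
    unfolding ey[symmetric] by (simp only: sum.distrib sum_divide_distrib)
  finally have b_y: "(\<Sum>i=1..M. \<Sum>j=0..N. Gy i j * ?dy i j) \<le> ?Y + energy_y e / 4" .
  have "(\<Sum>i=1..M. \<Sum>j=1..N. S i j * e i j) \<le>
      (\<Sum>i=1..M. \<Sum>j=1..N. mh T i * mk T j * 1 * (s i j)\<^sup>2 + mh T i * mk T j * ((e i j)\<^sup>2 / 1) / 4)"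
    using S x.w_nonneg y.w_nonneg by (intro sum_mono young) auto
  also have "\<dots> = ?Z + (\<Sum>i=1..M. \<Sum>j=1..N. mh T i * mk T j * (e i j)\<^sup>2) / 4"
    by (simp add: sum.distrib sum_divide_distrib)
  finally have bs: "(\<Sum>i=1..M. \<Sum>j=1..N. S i j * e i j) \<le>
      ?Z + (\<Sum>i=1..M. \<Sum>j=1..N. mh T i * mk T j * (e i j)\<^sup>2) / 4" .
  have "(\<Sum>i=1..M. \<Sum>j=1..N. mh T i * mk T j * (e i j)\<^sup>2) \<le>
      (\<Sum>i=0..M. \<Sum>j=0..N. mk T j * mh T i * (e i j)\<^sup>2)"
    by (simp add: sum.atLeast_Suc_atMost[of 0 M] sum.atLeast_Suc_atMost[of 0 N] x.w_0 y.w_0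
        mult.commute)
  also have "\<dots> \<le> energy_x e"
    by (rule poincare_x[OF e x.w_nonneg x.sum_w])
  finally have "(\<Sum>i=1..M. \<Sum>j=1..N. mh T i * mk T j * (e i j)\<^sup>2) \<le> energy_x e" .
  moreover have "a + b \<le> 2 * (X + Y + Z)" if "a + b = tx + ty + ts" "tx \<le> X + a / 4"
    "ty \<le> Y + b / 4" "ts \<le> Z + l / 4" "l \<le> a" "0 \<le> b" for a b tx ty ts l X Y Z :: real
    using that by argo
  ultimately show ?thesis
    using tested bx b_y bs energy_y_nonneg[of e] by blast
qed

end

section \<open>Consistency of the fluxes\<close>

lemma zero_derivative:
  fixes g :: "real \<Rightarrow> real"
  assumes "(g has_real_derivative d) (at x within {0..1})" "x \<in> {0..1}"
    and "\<And>t. t \<in> {0..1} \<Longrightarrow> g t = 0"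
  shows "d = 0"
proof -
  have "((\<lambda>t. 0) has_real_derivative d) (at x within {0..1})"
    by (rule has_field_derivative_transform_within[OF assms(1), where d = 1]) (use assms in auto)
  then have "vector_derivative (\<lambda>t. 0 :: real) (at x within {0..1}) = d"
    using assms(2) by (intro vector_derivative_within_closed_interval)
      (auto simp: has_real_derivative_iff_has_vector_derivative)
  moreover have "vector_derivative (\<lambda>t. 0 :: real) (at x within {0..1}) = 0"
    using assms(2) by (intro vector_derivative_within_closed_interval) auto
  ultimately show ?thesis by simp
qed

lemma closure_Omega: "closure Omega = Omega_bar"
  by (simp add: Omega_def Omega_bar_def closure_Times)

lemma frontier_Omega: "frontier Omega = Omega_bar - Omega"
  unfolding frontier_def closure_Omega by (simp add: Omega_def interior_open open_Times)

locale poisson =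
  fixes u f :: "real \<times> real \<Rightarrow> real"
  assumes u_C4: "C_bar 4 u" and f_C2: "C_bar 2 f"
    and equation: "p \<in> Omega \<Longrightarrow> - laplacian u p = f p"
    and boundary: "p \<in> frontier Omega \<Longrightarrow> u p = 0"
begin

abbreviation "D \<equiv> partial u"
abbreviation "B \<equiv> max_norm 4 u"

lemmas D_x = has_partial_x[OF u_C4] and D_y = has_partial_y[OF u_C4]

text \<open>
  The order of the derivative is a variable here so that numerals match it.
\<close>

lemma D_x':
  assumes "a' = Suc a" "a + b < 4" "x \<in> {0..1}" "y \<in> {0..1}"
  shows "((\<lambda>t. D a b (t, y)) has_real_derivative D a' b (x, y)) (at x within {0..1})"
  using D_x assms by simp

lemma D_y':
  assumes "b' = Suc b" "a + b < 4" "x \<in> {0..1}" "y \<in> {0..1}"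
  shows "((\<lambda>t. D a b (x, t)) has_real_derivative D a b' (x, y)) (at y within {0..1})"
  using D_y assms by simp

lemma D_0: "D 0 0 = u"
  by (simp add: partial_def)

lemma D_continuous: "a + b \<le> 4 \<Longrightarrow> continuous_on Omega_bar (D a b)"
  using partial_C_bar[OF u_C4, of a b 0] by simp

lemma D_bound: "a + b \<le> 4 \<Longrightarrow> x \<in> {0..1} \<Longrightarrow> y \<in> {0..1} \<Longrightarrow> \<bar>D a b (x, y)\<bar> \<le> B"
  using abs_partial_le_max_norm[OF u_C4] by (simp add: Omega_bar_def)

lemma B_nonneg: "0 \<le> B"
  using D_bound[of 0 0 0 0] by auto

text \<open>
  The equation holds inside the square by assumption and extends to the boundary by continuity.
\<close>

lemma f_eq:
  assumes "p \<in> Omega_bar"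
  shows "f p = - (D 2 0 p + D 0 2 p)"
proof -
  have "continuous_on (closure Omega) (\<lambda>p. f p + (D 2 0 p + D 0 2 p))"
    unfolding closure_Omega
    by (intro continuous_on_add D_continuous C_bar_continuous[OF f_C2]) simp_all
  moreover have "f p + (D 2 0 p + D 0 2 p) = 0" if "p \<in> Omega" for p
  proof -
    have "laplacian u p = D 2 0 p + D 0 2 p"
      by (simp add: laplacian_def partial_def numeral_2_eq_2)
    then show ?thesis using equation[OF that] by linarith
  qed
  moreover have "p \<in> closure Omega"
    using assms closure_Omega by simp
  ultimately have "f p + (D 2 0 p + D 0 2 p) = 0"
    by (rule continuous_constant_on_closure)
  then show ?thesis by simp
qed

lemma pdx_f_eq:
  assumes "p \<in> Omega_bar"
  shows "pdx f p = - (D 3 0 p + D 1 2 p)"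
proof -
  obtain x y where p: "p = (x, y)" "x \<in> {0..1}" "y \<in> {0..1}"
    using assms by (auto simp: Omega_bar_def)
  have "pdx f p = pdx (\<lambda>p. - (D 2 0 p + D 0 2 p)) p"
    using f_eq assms by (rule pdx_cong)
  also have "\<dots> = - (D (Suc 2) 0 p + D (Suc 0) 2 p)"
    unfolding p(1) by (intro pdx_eqI DERIV_minus DERIV_add D_x) (use p in auto)
  finally show ?thesis by (simp add: eval_nat_numeral)
qed

lemma pdx_pdx_f_eq:
  assumes "p \<in> Omega_bar"
  shows "pdx (pdx f) p = - (D 4 0 p + D 2 2 p)"
proof -
  obtain x y where p: "p = (x, y)" "x \<in> {0..1}" "y \<in> {0..1}"
    using assms by (auto simp: Omega_bar_def)
  have "pdx (pdx f) p = pdx (\<lambda>p. - (D 3 0 p + D 1 2 p)) p"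
    using pdx_f_eq assms by (rule pdx_cong)
  also have "\<dots> = - (D (Suc 3) 0 p + D (Suc 1) 2 p)"
    unfolding p(1) by (intro pdx_eqI DERIV_minus DERIV_add D_x) (use p in auto)
  finally show ?thesis by (simp add: eval_nat_numeral)
qed

lemma u_boundary:
  assumes "x \<in> {0..1}" "y \<in> {0..1}" "x \<in> {0, 1} \<or> y \<in> {0, 1}"
  shows "u (x, y) = 0"
proof -
  have "(x, y) \<in> frontier Omega"
    using assms unfolding frontier_Omega by (auto simp: Omega_bar_def Omega_def)
  then show ?thesis by (rule boundary)
qed

text \<open>
  On a side where \<open>u\<close> vanishes its tangential derivatives vanish too. For \<open>u\<^sub>y\<^sub>y\<close> on the vertical sides
  this says \<open>u\<^sub>x\<^sub>x = - f\<close> there, the boundary condition imposed on \<open>v\<close>.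
\<close>

lemma D_0_2_boundary:
  assumes "x \<in> {0, 1}" "y \<in> {0..1}"
  shows "D 0 2 (x, y) = 0"
proof -
  have "D 0 (Suc 0) (x, t) = 0" if "t \<in> {0..1}" for t
    by (rule zero_derivative[OF D_y[of 0 0 x t]]) (use that assms in \<open>auto simp: D_0 u_boundary\<close>)
  then have "D 0 (Suc (Suc 0)) (x, y) = 0"
    using assms by (intro zero_derivative[OF D_y[of 0 "Suc 0" x y]]) auto
  then show ?thesis by (simp add: numeral_2_eq_2)
qed

lemma D_2_0_boundary:
  assumes "x \<in> {0..1}" "y \<in> {0, 1}"
  shows "D 2 0 (x, y) = 0"
proof -
  have "D (Suc 0) 0 (t, y) = 0" if "t \<in> {0..1}" for t
    by (rule zero_derivative[OF D_x[of 0 0 t y]]) (use that assms in \<open>auto simp: D_0 u_boundary\<close>)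
  then have "D (Suc (Suc 0)) 0 (x, y) = 0"
    using assms by (intro zero_derivative[OF D_x[of "Suc 0" 0 x y]]) auto
  then show ?thesis by (simp add: numeral_2_eq_2)
qed

lemma integral_D_x_rectangle:
  assumes ab: "a + b < 4" and r: "0 \<le> p" "p \<le> q" "q \<le> 1" "0 \<le> c" "c \<le> d" "d \<le> 1"
  shows "integral ({p..q} \<times> {c..d}) (D (Suc a) b) =
    integral {c..d} (\<lambda>t. D a b (q, t)) - integral {c..d} (\<lambda>t. D a b (p, t))"
proof -
  have sub: "cbox (p, c) (q, d) \<subseteq> Omega_bar"
    using r by (auto simp: Omega_bar_def cbox_Pair_eq)
  have cont: "continuous_on (cbox (p, c) (q, d)) (D (Suc a) b)"
    using ab by (intro continuous_on_subset[OF D_continuous sub]) auto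
  have "integral ({p..q} \<times> {c..d}) (D (Suc a) b) = integral (cbox (p, c) (q, d)) (D (Suc a) b)"
    by (simp add: cbox_Pair_eq)
  also have "\<dots> = integral (cbox p q) (\<lambda>s. integral (cbox c d) (\<lambda>t. D (Suc a) b (s, t)))"
    by (rule integral_prod_continuous[OF cont])
  also have "\<dots> = integral (cbox c d) (\<lambda>t. integral (cbox p q) (\<lambda>s. D (Suc a) b (s, t)))"
    by (rule integral_swap_continuous) (use cont in simp)
  also have "\<dots> = integral {c..d} (\<lambda>t. D a b (q, t) - D a b (p, t))"
    unfolding cbox_interval
  proof (rule integral_cong)
    fix t assume "t \<in> {c..d}"
    then show "integral {p..q} (\<lambda>s. D (Suc a) b (s, t)) = D a b (q, t) - D a b (p, t)"
      using r by (intro integral_unique ftc_real D_x ab) auto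
  qed
  also have "\<dots> = integral {c..d} (\<lambda>t. D a b (q, t)) - integral {c..d} (\<lambda>t. D a b (p, t))"
    using r ab by (intro integral_diff integrable_continuous_real
        continuous_on_slice_y[OF D_continuous]) auto
  finally show ?thesis .
qed

lemma integral_D_y_rectangle:
  assumes ab: "a + b < 4" and r: "0 \<le> p" "p \<le> q" "q \<le> 1" "0 \<le> c" "c \<le> d" "d \<le> 1"
  shows "integral ({p..q} \<times> {c..d}) (D a (Suc b)) =
    integral {p..q} (\<lambda>s. D a b (s, d)) - integral {p..q} (\<lambda>s. D a b (s, c))"
proof -
  have sub: "cbox (p, c) (q, d) \<subseteq> Omega_bar"
    using r by (auto simp: Omega_bar_def cbox_Pair_eq)
  have cont: "continuous_on (cbox (p, c) (q, d)) (D a (Suc b))"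
    using ab by (intro continuous_on_subset[OF D_continuous sub]) auto
  have "integral ({p..q} \<times> {c..d}) (D a (Suc b)) = integral (cbox (p, c) (q, d)) (D a (Suc b))"
    by (simp add: cbox_Pair_eq)
  also have "\<dots> = integral (cbox p q) (\<lambda>s. integral (cbox c d) (\<lambda>t. D a (Suc b) (s, t)))"
    by (rule integral_prod_continuous[OF cont])
  also have "\<dots> = integral {p..q} (\<lambda>s. D a b (s, d) - D a b (s, c))"
    unfolding cbox_interval
  proof (rule integral_cong)
    fix s assume "s \<in> {p..q}"
    then show "integral {c..d} (\<lambda>t. D a (Suc b) (s, t)) = D a b (s, d) - D a b (s, c)"
      using r by (intro integral_unique ftc_real D_y ab) auto
  qed
  also have "\<dots> = integral {p..q} (\<lambda>s. D a b (s, d)) - integral {p..q} (\<lambda>s. D a b (s, c))"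
    using r ab by (intro integral_diff integrable_continuous_real
        continuous_on_slice_x[OF D_continuous]) auto
  finally show ?thesis .
qed

end

text \<open>
  Passes from differences to discrete fluxes. The second-order coefficient
  simplifies because \<open>(q - m)\<^sup>2 - (m - p)\<^sup>2\<close> contains the factor \<open>q - p\<close>.
\<close>

lemma rescaled_difference_quotient:
  fixes k :: real
  assumes "\<bar>A - ((q - p) * c0 + ((q - m)\<^sup>2 - (m - p)\<^sup>2) / 2 * c1)\<bar> \<le> (q - p) * E"
    and "p < q" "0 \<le> k"
  shows "\<bar>k * (A / (q - p)) - (k * c0 + k * (((q - m) - (m - p)) / 2) * c1)\<bar> \<le> k * E"
proof -
  have "A / (q - p) - (c0 + ((q - m) - (m - p)) / 2 * c1)
      = (A - ((q - p) * c0 + ((q - m)\<^sup>2 - (m - p)\<^sup>2) / 2 * c1)) / (q - p)"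
    using assms(2) by (simp add: field_simps power2_eq_square)
  then have "\<bar>A / (q - p) - (c0 + ((q - m) - (m - p)) / 2 * c1)\<bar> \<le> E"
    using assms(1,2) by (simp add: divide_le_eq mult.commute)
  then have "k * \<bar>A / (q - p) - (c0 + ((q - m) - (m - p)) / 2 * c1)\<bar> \<le> k * E"
    using assms(3) by (rule mult_left_mono)
  then have "\<bar>k * (A / (q - p) - (c0 + ((q - m) - (m - p)) / 2 * c1))\<bar> \<le> k * E"
    using assms(3) by (simp add: abs_mult)
  then show ?thesis by (simp add: algebra_simps)
qed

locale poisson_mesh = poisson u f + admissible T for u f T
begin

text \<open>
  The discrete flux of \<open>\<partial>\<^sub>x\<^sup>a \<partial>\<^sub>y\<^sup>b u\<close> through a vertical edge minus the exact one. The orders \<open>a = b = 0\<close>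
  serve for the approximation of \<open>u\<close>, and \<open>a = 2\<close>, \<open>b = 0\<close> for that of \<open>u\<^sub>x\<^sub>x\<close>.
\<close>

definition flux_error_x :: "nat \<Rightarrow> nat \<Rightarrow> nat \<Rightarrow> nat \<Rightarrow> real" where
  "flux_error_x a b i j =
     mk T j * ((D a b (mx T (Suc i), my T j) - D a b (mx T i, my T j)) / h_half T i)
     - integral {y_half T (j - 1)..y_half T j} (\<lambda>t. D (Suc a) b (x_half T i, t))"

definition flux_error_y :: "nat \<Rightarrow> nat \<Rightarrow> nat \<Rightarrow> nat \<Rightarrow> real" where
  "flux_error_y a b i j =
     mh T i * ((D a b (mx T i, my T (Suc j)) - D a b (mx T i, my T j)) / k_half T j)
     - integral {x_half T (i - 1)..x_half T i} (\<lambda>s. D a (Suc b) (s, y_half T j))"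

text \<open>
  By the divergence theorem on a cell, the exact fluxes add up to the integral of the Laplacian.
\<close>

lemma discrete_laplacian_D:
  assumes i: "i \<in> {1..M}" and j: "j \<in> {1..N}" and ab: "a + b \<le> 2"
  shows "discrete_laplacian T (\<lambda>i j. D a b (mx T i, my T j)) i j =
    - (flux_error_x a b i j - flux_error_x a b (i - 1) j)
    - (flux_error_y a b i j - flux_error_y a b i (j - 1))
    - integral (cell T i j) (\<lambda>p. D (Suc (Suc a)) b p + D a (Suc (Suc b)) p)"
proof -
  have r: "0 \<le> x_half T (i - 1)" "x_half T (i - 1) \<le> x_half T i" "x_half T i \<le> 1"
    "0 \<le> y_half T (j - 1)" "y_half T (j - 1) \<le> y_half T j" "y_half T j \<le> 1"
    using x.edge_mono[of "i - 1" i] y.edge_mono[of "j - 1" j] x.edge_unit[of "i - 1"]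
      x.edge_unit[of i] y.edge_unit[of "j - 1"] y.edge_unit[of j] i j by auto
  have cell: "cell T i j = cbox (x_half T (i - 1), y_half T (j - 1)) (x_half T i, y_half T j)"
    by (simp add: cell_def cbox_Pair_eq)
  have sub: "cell T i j \<subseteq> Omega_bar"
    using r by (auto simp: cell_def Omega_bar_def)
  have "D (Suc (Suc a)) b integrable_on cell T i j" "D a (Suc (Suc b)) integrable_on cell T i j"
    using ab sub unfolding cell
    by (auto intro!: integrable_continuous continuous_on_subset[OF D_continuous])
  then have "integral (cell T i j) (\<lambda>p. D (Suc (Suc a)) b p + D a (Suc (Suc b)) p) =
      integral (cell T i j) (D (Suc (Suc a)) b) + integral (cell T i j) (D a (Suc (Suc b)))"
    by (rule integral_add)
  also have "\<dots> =
      (integral {y_half T (j - 1)..y_half T j} (\<lambda>t. D (Suc a) b (x_half T i, t)) -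
       integral {y_half T (j - 1)..y_half T j} (\<lambda>t. D (Suc a) b (x_half T (i - 1), t))) +
      (integral {x_half T (i - 1)..x_half T i} (\<lambda>s. D a (Suc b) (s, y_half T j)) -
       integral {x_half T (i - 1)..x_half T i} (\<lambda>s. D a (Suc b) (s, y_half T (j - 1))))"
    unfolding cell_def
    by (subst integral_D_x_rectangle, use ab r in auto)
       (subst integral_D_y_rectangle, use ab r in auto)
  finally have divergence: "integral (cell T i j) (\<lambda>p. D (Suc (Suc a)) b p + D a (Suc (Suc b)) p) = \<dots>" .
  have "Suc (i - 1) = i" "Suc (j - 1) = j" using i j by auto
  then show ?thesis
    unfolding discrete_laplacian_flux_form flux_error_x_def flux_error_y_def divergence
    by (simp only:)
qed

lemma x_local:
  assumes "i \<le> M"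
  shows "0 \<le> mx T i" "mx T i \<le> x_half T i" "x_half T i \<le> mx T (Suc i)" "mx T (Suc i) \<le> 1"
    "x_half T i - mx T i \<le> H" "mx T (Suc i) - x_half T i \<le> H"
  using x.point_unit[of i] x.point_unit[of "Suc i"] x.point_le_edge[OF assms]
    x.edge_le_point[OF assms] x.right_le[OF assms] x.left_le[OF assms] assms by auto

lemma y_local:
  assumes "j \<le> N"
  shows "0 \<le> my T j" "my T j \<le> y_half T j" "y_half T j \<le> my T (Suc j)" "my T (Suc j) \<le> 1"
    "y_half T j - my T j \<le> H" "my T (Suc j) - y_half T j \<le> H"
  using y.point_unit[of j] y.point_unit[of "Suc j"] y.point_le_edge[OF assms]
    y.edge_le_point[OF assms] y.right_le[OF assms] y.left_le[OF assms] assms by auto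

lemma x_cell:
  assumes "i \<in> {1..M}"
  shows "0 \<le> x_half T (i - 1)" "x_half T (i - 1) \<le> mx T i" "mx T i \<le> x_half T i"
    "x_half T i \<le> 1" "mx T i - x_half T (i - 1) \<le> H" "x_half T i - mx T i \<le> H"
    "x_half T i - x_half T (i - 1) = mh T i"
  using x_local[of "i - 1"] x_local[of i] x.edge_unit[of i] x.edge_unit[of "i - 1"]
    x.edge_Suc[of "i - 1"] assms by auto

lemma y_cell:
  assumes "j \<in> {1..N}"
  shows "0 \<le> y_half T (j - 1)" "y_half T (j - 1) \<le> my T j" "my T j \<le> y_half T j"
    "y_half T j \<le> 1" "my T j - y_half T (j - 1) \<le> H" "y_half T j - my T j \<le> H"
    "y_half T j - y_half T (j - 1) = mk T j"
  using y_local[of "j - 1"] y_local[of j] y.edge_unit[of j] y.edge_unit[of "j - 1"]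
    y.edge_Suc[of "j - 1"] assms by auto

lemma flux_error_x_first_order:
  assumes i: "i \<le> M" and j: "j \<in> {1..N}" and ab: "a + b \<le> 2"
  shows "\<bar>flux_error_x a b i j\<bar> \<le> mk T j * (2 * B * H)"
proof -
  let ?X = "x_half T i" and ?y = "my T j"
  have u: "?X \<in> {0..1}" "?y \<in> {0..1}" using x.edge_unit[OF i] y_cell[OF j] by auto
  have k: "0 \<le> mk T j" using y.w_nonneg j by auto
  have "\<bar>D a b (mx T (Suc i), ?y) - D a b (mx T i, ?y)
      - (mx T (Suc i) - mx T i) * D (Suc a) b (?X, ?y)\<bar> \<le> (mx T (Suc i) - mx T i) * (B * H)"
    by (rule difference_first_order[where g'' = "\<lambda>t. D (Suc (Suc a)) b (t, ?y)"])
       (use ab u x_local[OF i] in \<open>auto intro!: D_x D_bound\<close>)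
  then have "\<bar>mk T j * ((D a b (mx T (Suc i), ?y) - D a b (mx T i, ?y)) / h_half T i)
      - mk T j * D (Suc a) b (?X, ?y)\<bar> \<le> mk T j * (B * H)"
    using rescaled_difference_quotient[where ?c1.0 = 0 and k = "mk T j" and p = "mx T i"
        and q = "mx T (Suc i)" and ?c0.0 = "D (Suc a) b (?X, ?y)"
        and A = "D a b (mx T (Suc i), ?y) - D a b (mx T i, ?y)"] x.gap_pos[OF i] k
    by (simp add: h_half_def)
  moreover have "\<bar>integral {y_half T (j - 1)..y_half T j} (\<lambda>t. D (Suc a) b (?X, t))
      - (y_half T j - y_half T (j - 1)) * D (Suc a) b (?X, ?y)\<bar>
      \<le> (y_half T j - y_half T (j - 1)) * (B * H)"
    by (rule quadrature_first_order[where g' = "\<lambda>t. D (Suc a) (Suc b) (?X, t)"])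
       (use ab u y_cell[OF j] in \<open>auto intro!: D_y D_bound\<close>)
  ultimately show ?thesis
    unfolding flux_error_x_def y_cell(7)[OF j] by (simp add: abs_le_iff algebra_simps)
qed

lemma flux_error_y_first_order:
  assumes i: "i \<in> {1..M}" and j: "j \<le> N" and ab: "a + b \<le> 2"
  shows "\<bar>flux_error_y a b i j\<bar> \<le> mh T i * (2 * B * H)"
proof -
  let ?x = "mx T i" and ?Y = "y_half T j"
  have u: "?x \<in> {0..1}" "?Y \<in> {0..1}" using y.edge_unit[OF j] x_cell[OF i] by auto
  have k: "0 \<le> mh T i" using x.w_nonneg i by auto
  have "\<bar>D a b (?x, my T (Suc j)) - D a b (?x, my T j)
      - (my T (Suc j) - my T j) * D a (Suc b) (?x, ?Y)\<bar> \<le> (my T (Suc j) - my T j) * (B * H)"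
    by (rule difference_first_order[where g'' = "\<lambda>t. D a (Suc (Suc b)) (?x, t)"])
       (use ab u y_local[OF j] in \<open>auto intro!: D_y D_bound\<close>)
  then have "\<bar>mh T i * ((D a b (?x, my T (Suc j)) - D a b (?x, my T j)) / k_half T j)
      - mh T i * D a (Suc b) (?x, ?Y)\<bar> \<le> mh T i * (B * H)"
    using rescaled_difference_quotient[where ?c1.0 = 0 and k = "mh T i" and p = "my T j"
        and q = "my T (Suc j)" and ?c0.0 = "D a (Suc b) (?x, ?Y)"
        and A = "D a b (?x, my T (Suc j)) - D a b (?x, my T j)"] y.gap_pos[OF j] k
    by (simp add: k_half_def)
  moreover have "\<bar>integral {x_half T (i - 1)..x_half T i} (\<lambda>s. D a (Suc b) (s, ?Y))
      - (x_half T i - x_half T (i - 1)) * D a (Suc b) (?x, ?Y)\<bar>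
      \<le> (x_half T i - x_half T (i - 1)) * (B * H)"
    by (rule quadrature_first_order[where g' = "\<lambda>s. D (Suc a) (Suc b) (s, ?Y)"])
       (use ab u x_cell[OF i] in \<open>auto intro!: D_x D_bound\<close>)
  ultimately show ?thesis
    unfolding flux_error_y_def x_cell(7)[OF i] by (simp add: abs_le_iff algebra_simps)
qed

text \<open>
  The part of the flux error that comes from the position of the mesh point along the edge. It is
  of first order only, and is compensated after differencing across the cell.
\<close>

definition transverse_x :: "nat \<Rightarrow> nat \<Rightarrow> real" where
  "transverse_x i j = ((k_plus T j)\<^sup>2 - (k_minus T j)\<^sup>2) / 2 * D 1 1 (x_half T i, my T j)"

definition transverse_y :: "nat \<Rightarrow> nat \<Rightarrow> real" where
  "transverse_y i j = ((h_plus T i)\<^sup>2 - (h_minus T i)\<^sup>2) / 2 * D 1 1 (mx T i, y_half T j)"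

lemma D_1_1: "D 1 1 = D (Suc 0) (Suc 0)"
  by simp

lemma flux_error_x_second_order:
  assumes i: "i \<le> M" and j: "j \<in> {1..N}"
  shows "\<bar>flux_error_x 0 0 i j -
      (mk T j * ((h_minus T (Suc i) - h_plus T i) / 2) * D 2 0 (x_half T i, my T j)
       - transverse_x i j)\<bar> \<le> mk T j * (2 * B * H\<^sup>2)"
proof -
  let ?X = "x_half T i" and ?y = "my T j"
  have u: "?X \<in> {0..1}" "?y \<in> {0..1}" using x.edge_unit[OF i] y_cell[OF j] by auto
  have k: "0 \<le> mk T j" using y.w_nonneg j by auto
  have "\<bar>D 0 0 (mx T (Suc i), ?y) - D 0 0 (mx T i, ?y)
      - ((mx T (Suc i) - mx T i) * D (Suc 0) 0 (?X, ?y)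
         + ((mx T (Suc i) - ?X)\<^sup>2 - (?X - mx T i)\<^sup>2) / 2 * D (Suc (Suc 0)) 0 (?X, ?y))\<bar>
      \<le> (mx T (Suc i) - mx T i) * (B * H\<^sup>2)"
    by (rule difference_second_order[where g''' = "\<lambda>t. D (Suc (Suc (Suc 0))) 0 (t, ?y)"])
       (use u x_local[OF i] in \<open>auto intro!: D_x D_bound\<close>)
  from rescaled_difference_quotient[OF this _ k] x.gap_pos[OF i]
  have "\<bar>mk T j * ((D 0 0 (mx T (Suc i), ?y) - D 0 0 (mx T i, ?y)) / h_half T i)
      - (mk T j * D (Suc 0) 0 (?X, ?y)
         + mk T j * ((h_minus T (Suc i) - h_plus T i) / 2) * D (Suc (Suc 0)) 0 (?X, ?y))\<bar>
      \<le> mk T j * (B * H\<^sup>2)"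
    by (simp add: h_half_def h_minus_def h_plus_def)
  moreover have "\<bar>integral {y_half T (j - 1)..y_half T j} (\<lambda>t. D (Suc 0) 0 (?X, t))
      - ((y_half T j - y_half T (j - 1)) * D (Suc 0) 0 (?X, ?y)
         + ((y_half T j - ?y)\<^sup>2 - (?y - y_half T (j - 1))\<^sup>2) / 2 * D (Suc 0) (Suc 0) (?X, ?y))\<bar>
      \<le> (y_half T j - y_half T (j - 1)) * (B * H\<^sup>2)"
    by (rule quadrature_second_order[where g'' = "\<lambda>t. D (Suc 0) (Suc (Suc 0)) (?X, t)"])
       (use u y_cell[OF j] in \<open>auto intro!: D_y D_bound\<close>)
  then have "\<bar>integral {y_half T (j - 1)..y_half T j} (\<lambda>t. D (Suc 0) 0 (?X, t))
      - (mk T j * D (Suc 0) 0 (?X, ?y) + transverse_x i j)\<bar> \<le> mk T j * (B * H\<^sup>2)"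
    unfolding transverse_x_def k_plus_def k_minus_def y_cell(7)[OF j] D_1_1 .
  ultimately show ?thesis
    unfolding flux_error_x_def numeral_2_eq_2 by linarith
qed

lemma flux_error_y_second_order:
  assumes i: "i \<in> {1..M}" and j: "j \<le> N"
  shows "\<bar>flux_error_y 0 0 i j -
      (mh T i * ((k_minus T (Suc j) - k_plus T j) / 2) * D 0 2 (mx T i, y_half T j)
       - transverse_y i j)\<bar> \<le> mh T i * (2 * B * H\<^sup>2)"
proof -
  let ?x = "mx T i" and ?Y = "y_half T j"
  have u: "?x \<in> {0..1}" "?Y \<in> {0..1}" using y.edge_unit[OF j] x_cell[OF i] by auto
  have k: "0 \<le> mh T i" using x.w_nonneg i by auto
  have "\<bar>D 0 0 (?x, my T (Suc j)) - D 0 0 (?x, my T j)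
      - ((my T (Suc j) - my T j) * D 0 (Suc 0) (?x, ?Y)
         + ((my T (Suc j) - ?Y)\<^sup>2 - (?Y - my T j)\<^sup>2) / 2 * D 0 (Suc (Suc 0)) (?x, ?Y))\<bar>
      \<le> (my T (Suc j) - my T j) * (B * H\<^sup>2)"
    by (rule difference_second_order[where g''' = "\<lambda>t. D 0 (Suc (Suc (Suc 0))) (?x, t)"])
       (use u y_local[OF j] in \<open>auto intro!: D_y D_bound\<close>)
  from rescaled_difference_quotient[OF this _ k] y.gap_pos[OF j]
  have "\<bar>mh T i * ((D 0 0 (?x, my T (Suc j)) - D 0 0 (?x, my T j)) / k_half T j)
      - (mh T i * D 0 (Suc 0) (?x, ?Y)
         + mh T i * ((k_minus T (Suc j) - k_plus T j) / 2) * D 0 (Suc (Suc 0)) (?x, ?Y))\<bar>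
      \<le> mh T i * (B * H\<^sup>2)"
    by (simp add: k_half_def k_minus_def k_plus_def)
  moreover have "\<bar>integral {x_half T (i - 1)..x_half T i} (\<lambda>s. D 0 (Suc 0) (s, ?Y))
      - ((x_half T i - x_half T (i - 1)) * D 0 (Suc 0) (?x, ?Y)
         + ((x_half T i - ?x)\<^sup>2 - (?x - x_half T (i - 1))\<^sup>2) / 2 * D (Suc 0) (Suc 0) (?x, ?Y))\<bar>
      \<le> (x_half T i - x_half T (i - 1)) * (B * H\<^sup>2)"
    by (rule quadrature_second_order[where g'' = "\<lambda>s. D (Suc (Suc 0)) (Suc 0) (s, ?Y)"])
       (use u x_cell[OF i] in \<open>auto intro!: D_x D_bound\<close>)
  then have "\<bar>integral {x_half T (i - 1)..x_half T i} (\<lambda>s. D 0 (Suc 0) (s, ?Y))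
      - (mh T i * D 0 (Suc 0) (?x, ?Y) + transverse_y i j)\<bar> \<le> mh T i * (B * H\<^sup>2)"
    unfolding transverse_y_def h_plus_def h_minus_def x_cell(7)[OF i] D_1_1 .
  ultimately show ?thesis
    unfolding flux_error_y_def numeral_2_eq_2 by linarith
qed

end

section \<open>Second-order convergence\<close>

text \<open>
  One direction of the volume residual, in the abstract. The increment \<open>r\<close> of the mixed derivative
  over a cell of width \<open>h\<close> is \<open>h c\<close> up to first order, \<open>e1\<close> and \<open>e2\<close> are first-order approximations of
  the third derivative \<open>c\<close>, and \<open>d1\<close>, \<open>d2\<close> are the perturbations caused by replacing \<open>u\<^sub>x\<^sub>x\<close> with \<open>v\<close>.
\<close>

lemma transverse_residual_split_bound:
  fixes h a b c r e1 e2 d1 d2 H K :: real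
  assumes ab: "0 \<le> a" "0 \<le> b" "a + b \<le> H" and h: "0 \<le> h" and K: "0 \<le> K"
    and r: "\<bar>r - h * c\<bar> \<le> h * K" and e: "\<bar>e1 - c\<bar> \<le> 4 * K" "\<bar>e2 - c\<bar> \<le> 4 * K"
  shows "\<bar>(a\<^sup>2 - b\<^sup>2) / 2 * r - (h * (a\<^sup>2 / 2) * (e1 + d1) - h * (b\<^sup>2 / 2) * (e2 + d2))\<bar>
    \<le> h * (a + b) * (5 / 2 * (K * H) + a / 2 * \<bar>d1\<bar> + b / 2 * \<bar>d2\<bar>)"
proof -
  let ?k = "a + b"
  have sq: "a\<^sup>2 + b\<^sup>2 \<le> ?k * H" "a\<^sup>2 \<le> ?k * a" "b\<^sup>2 \<le> ?k * b"
  proof -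
    have "a\<^sup>2 + b\<^sup>2 \<le> ?k * ?k" using ab by (simp add: power2_eq_square algebra_simps)
    also have "\<dots> \<le> ?k * H" using ab by (intro mult_left_mono) auto
    finally show "a\<^sup>2 + b\<^sup>2 \<le> ?k * H" .
  qed (use ab in \<open>auto simp: power2_eq_square algebra_simps\<close>)
  have "\<bar>a\<^sup>2 - b\<^sup>2\<bar> \<le> a\<^sup>2 + b\<^sup>2" by (simp add: abs_le_iff)
  then have t1: "\<bar>(a\<^sup>2 - b\<^sup>2) / 2 * (r - h * c)\<bar> \<le> (?k * H) / 2 * (h * K)"
    unfolding abs_mult using sq(1) r ab by (intro mult_mono) auto
  have t2: "\<bar>h * (a\<^sup>2 / 2) * (e1 - c)\<bar> \<le> h * (a\<^sup>2 / 2) * (4 * K)"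
    using mult_left_mono[OF e(1), of "h * (a\<^sup>2 / 2)"] h by (simp add: abs_mult)
  have t3: "\<bar>h * (b\<^sup>2 / 2) * (e2 - c)\<bar> \<le> h * (b\<^sup>2 / 2) * (4 * K)"
    using mult_left_mono[OF e(2), of "h * (b\<^sup>2 / 2)"] h by (simp add: abs_mult)
  have "h * (2 * K) * (a\<^sup>2 + b\<^sup>2) \<le> h * (2 * K) * (?k * H)"
    using sq(1) h K by (intro mult_left_mono) auto
  then have t23: "h * (a\<^sup>2 / 2) * (4 * K) + h * (b\<^sup>2 / 2) * (4 * K) \<le> 2 * (h * ?k * (K * H))"
    by (simp add: algebra_simps)
  have t4: "\<bar>h * (a\<^sup>2 / 2) * d1\<bar> \<le> h * ?k * (a / 2 * \<bar>d1\<bar>)"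
  proof -
    have "(h / 2 * \<bar>d1\<bar>) * a\<^sup>2 \<le> (h / 2 * \<bar>d1\<bar>) * (?k * a)"
      using sq(2) h by (intro mult_left_mono) auto
    then show ?thesis using h by (simp add: abs_mult mult_ac)
  qed
  have t5: "\<bar>h * (b\<^sup>2 / 2) * d2\<bar> \<le> h * ?k * (b / 2 * \<bar>d2\<bar>)"
  proof -
    have "(h / 2 * \<bar>d2\<bar>) * b\<^sup>2 \<le> (h / 2 * \<bar>d2\<bar>) * (?k * b)"
      using sq(3) h by (intro mult_left_mono) auto
    then show ?thesis using h by (simp add: abs_mult mult_ac)
  qed
  have "(a\<^sup>2 - b\<^sup>2) / 2 * r - (h * (a\<^sup>2 / 2) * (e1 + d1) - h * (b\<^sup>2 / 2) * (e2 + d2))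
      = (a\<^sup>2 - b\<^sup>2) / 2 * (r - h * c) - h * (a\<^sup>2 / 2) * (e1 - c) + h * (b\<^sup>2 / 2) * (e2 - c)
        - h * (a\<^sup>2 / 2) * d1 + h * (b\<^sup>2 / 2) * d2"
    by (simp add: field_simps)
  also have "\<bar>\<dots>\<bar> \<le> (?k * H) / 2 * (h * K) + 2 * (h * ?k * (K * H))
      + h * ?k * (a / 2 * \<bar>d1\<bar>) + h * ?k * (b / 2 * \<bar>d2\<bar>)"
    using t1 t2 t3 t23 t4 t5 by linarith
  also have "\<dots> = h * ?k * (5 / 2 * (K * H) + a / 2 * \<bar>d1\<bar> + b / 2 * \<bar>d2\<bar>)"
    by (simp add: field_simps)
  finally show ?thesis .
qed

lemma square_sum_five_le:
  fixes a b c d e :: real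
  shows "(a + b + c + d + e)\<^sup>2 \<le> 5 * (a\<^sup>2 + b\<^sup>2 + c\<^sup>2 + d\<^sup>2 + e\<^sup>2)"
proof -
  have "0 \<le> (a - b)\<^sup>2 + (a - c)\<^sup>2 + (a - d)\<^sup>2 + (a - e)\<^sup>2 + (b - c)\<^sup>2 + (b - d)\<^sup>2 + (b - e)\<^sup>2
      + (c - d)\<^sup>2 + (c - e)\<^sup>2 + (d - e)\<^sup>2"
    by (intro add_nonneg_nonneg) auto
  also have "\<dots> = 5 * (a\<^sup>2 + b\<^sup>2 + c\<^sup>2 + d\<^sup>2 + e\<^sup>2) - (a + b + c + d + e)\<^sup>2"
    by (simp add: power2_eq_square algebra_simps)
  finally show ?thesis by simp
qed

text \<open>
  How the perturbations of the previous estimate, squared and weighted with the cell area, are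
  absorbed by the energy: one factor \<open>a\<close> is traded for the distance \<open>g\<close> of the mesh points.
\<close>

lemma weighted_quotient_bound:
  fixes h k a g d H :: real
  assumes "0 \<le> h" "0 \<le> k" "k \<le> H" "0 \<le> a" "a \<le> H" "a \<le> g" "0 < g"
  shows "h * k * (a / 2 * \<bar>d / g\<bar>)\<^sup>2 \<le> H\<^sup>2 / 4 * (h * (d\<^sup>2 / g))"
proof -
  have "k * (a * a) \<le> H * (H * g)"
    using assms by (intro mult_mono) auto
  then have "h * (d\<^sup>2 / g\<^sup>2) / 4 * (k * (a * a)) \<le> h * (d\<^sup>2 / g\<^sup>2) / 4 * (H * (H * g))"
    using assms by (intro mult_left_mono) auto
  then show ?thesis
    using assms by (simp add: power_mult_distrib power_divide power2_eq_square mult_ac)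
qed

lemma sum_shift_le:
  fixes F :: "nat \<Rightarrow> real"
  assumes "\<And>i. i \<le> n \<Longrightarrow> 0 \<le> F i"
  shows "(\<Sum>i=1..n. F (i - 1)) \<le> (\<Sum>i=0..n. F i)"
proof -
  have "(\<Sum>i=1..n. F (i - 1)) = (\<Sum>i<n. F i)"
    by (rule sum.reindex_bij_witness[of _ Suc "\<lambda>i. i - 1"]) auto
  also have "\<dots> \<le> (\<Sum>i=0..n. F i)"
    using assms by (intro sum_mono2) auto
  finally show ?thesis .
qed

lemma sum_tail_le:
  fixes F :: "nat \<Rightarrow> real"
  assumes "\<And>i. i \<le> n \<Longrightarrow> 0 \<le> F i"
  shows "(\<Sum>i=1..n. F i) \<le> (\<Sum>i=0..n. F i)"
  using assms by (intro sum_mono2) auto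

context admissible
begin

lemma discrete_laplacian_cong:
  assumes "i \<in> {1..M}" "j \<in> {1..N}"
    and "\<And>i j. i \<le> Suc M \<Longrightarrow> j \<le> Suc N \<Longrightarrow> a i j = b i j"
  shows "discrete_laplacian T a i j = discrete_laplacian T b i j"
proof -
  have "i - 1 \<le> Suc M" "j - 1 \<le> Suc N" using assms by auto
  then show ?thesis
    using assms(3)[of i j] assms(3)[of "Suc i" j] assms(3)[of "i - 1" j] assms(3)[of i "Suc j"]
      assms(3)[of i "j - 1"] assms(1,2)
    by (simp add: discrete_laplacian_def)
qed

lemma discrete_laplacian_diff:
  "discrete_laplacian T (\<lambda>i j. a i j - b i j) i j = discrete_laplacian T a i j - discrete_laplacian T b i j"
proof -
  have "(a' - b' - (a'' - b'')) / g = (a' - a'') / g - (b' - b'') / g" for a' b' a'' b'' g :: real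
    by (simp add: diff_divide_distrib)
  then show ?thesis
    by (simp add: discrete_laplacian_def right_diff_distrib)
qed

lemma sum_weights_xy:
  "(\<Sum>i=0..M. \<Sum>j=1..N. mk T j * h_half T i * c) = c"
  "(\<Sum>i=1..M. \<Sum>j=0..N. mh T i * k_half T j * c) = c"
  "(\<Sum>i=1..M. \<Sum>j=1..N. mh T i * mk T j * c) = c"
proof -
  have prod: "(\<Sum>i\<in>A. \<Sum>j\<in>J. p i * q j * c) = sum p A * sum q J * c"
    for A J :: "nat set" and p q :: "nat \<Rightarrow> real"
    by (simp only: sum_product) (simp only: sum_distrib_right)
  show "(\<Sum>i=0..M. \<Sum>j=1..N. mk T j * h_half T i * c) = c"
    using prod[of "h_half T" "mk T" "{1..N}" "{0..M}"] sum_h_half y.sum_w_Suc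
    by (simp add: mult.commute)
  show "(\<Sum>i=1..M. \<Sum>j=0..N. mh T i * k_half T j * c) = c"
    using prod[of "mh T" "k_half T" "{0..N}" "{1..M}"] sum_k_half x.sum_w_Suc by simp
  show "(\<Sum>i=1..M. \<Sum>j=1..N. mh T i * mk T j * c) = c"
    using prod[of "mh T" "mk T" "{1..N}" "{1..M}"] y.sum_w_Suc x.sum_w_Suc by simp
qed

end

locale corrected_scheme = poisson_mesh u f T for u f T +
  fixes v u1 :: "nat \<Rightarrow> nat \<Rightarrow> real"
  assumes v: "is_approx_uxx T f v" and u1: "is_first_correction T f v u1"
begin

definition uxx_error :: "nat \<Rightarrow> nat \<Rightarrow> real" where
  "uxx_error i j = D 2 0 (mx T i, my T j) - v i j"

abbreviation "w \<equiv> uxx_error"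
abbreviation "e \<equiv> grid_error T u u1"

lemma zero_trace_uxx_error: "zero_trace w"
proof -
  have "w i 0 = 0 \<and> w i (Suc N) = 0" if "i \<le> Suc M" for i
    using that v x.point_unit[OF that] y.p_0 y.p_end
    by (auto simp: uxx_error_def is_approx_uxx_def D_2_0_boundary)
  moreover have "w 0 j = 0 \<and> w (Suc M) j = 0" if "j \<le> Suc N" for j
  proof -
    have "D 2 0 (s, my T j) = - f (s, my T j)" if "s \<in> {0, 1}" for s
      using f_eq[of "(s, my T j)"] D_0_2_boundary[OF that y.point_unit] that
        y.point_unit[OF \<open>j \<le> Suc N\<close>] \<open>j \<le> Suc N\<close> by (auto simp: Omega_bar_def)
    then show ?thesis
      using that v x.p_0 x.p_end by (simp add: uxx_error_def is_approx_uxx_def)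
  qed
  ultimately show ?thesis by (simp add: zero_trace_def)
qed

text \<open>
  Without corrections the fluxes are accurate to first order, and there is no volume residual, since
  \<open>u\<^sub>x\<^sub>x\<close> satisfies \<open>- \<Delta> u\<^sub>x\<^sub>x = f\<^sub>x\<^sub>x\<close>.
\<close>

lemma uxx_error_bound: "energy_x w + energy_y w \<le> 16 * (B\<^sup>2 * H\<^sup>2)"
proof -
  have "energy_x w + energy_y w \<le> 2 * (
      (\<Sum>i=0..M. \<Sum>j=1..N. mk T j * h_half T i * (2 * B * H)\<^sup>2) +
      (\<Sum>i=1..M. \<Sum>j=0..N. mh T i * k_half T j * (2 * B * H)\<^sup>2) +
      (\<Sum>i=1..M. \<Sum>j=1..N. mh T i * mk T j * 0\<^sup>2))"
  proof (rule energy_estimate[OF zero_trace_uxx_error,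
        where Gx = "flux_error_x 2 0" and Gy = "flux_error_y 2 0" and S = "\<lambda>i j. 0"])
    fix i j assume ij: "i \<in> {1..M}" "j \<in> {1..N}"
    have "integral (cell T i j) (\<lambda>p. D (Suc (Suc 2)) 0 p + D 2 (Suc (Suc 0)) p)
        = integral (cell T i j) (\<lambda>p. - pdx (pdx f) p)"
    proof (rule integral_cong)
      fix p assume "p \<in> cell T i j"
      then have "p \<in> Omega_bar"
        using x_cell[OF ij(1)] y_cell[OF ij(2)] by (auto simp: cell_def Omega_bar_def)
      from pdx_pdx_f_eq[OF this]
      show "D (Suc (Suc 2)) 0 p + D 2 (Suc (Suc 0)) p = - pdx (pdx f) p"
        by (simp add: eval_nat_numeral)
    qed
    then have "integral (cell T i j) (\<lambda>p. D (Suc (Suc 2)) 0 p + D 2 (Suc (Suc 0)) p)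
        = - discrete_laplacian T v i j"
      using v ij by (simp add: is_approx_uxx_def)
    then show "discrete_laplacian T w i j =
        - (flux_error_x 2 0 i j - flux_error_x 2 0 (i - 1) j)
        - (flux_error_y 2 0 i j - flux_error_y 2 0 i (j - 1)) + 0"
      using discrete_laplacian_D[OF ij, of 2 0] unfolding uxx_error_def discrete_laplacian_diff
      by simp
  qed (use flux_error_x_first_order flux_error_y_first_order in auto)
  also have "\<dots> = 16 * (B\<^sup>2 * H\<^sup>2)"
    by (simp only: sum_weights_xy) (simp add: power_mult_distrib)
  finally show ?thesis .
qed

lemma grid_error_eq:
  assumes "i \<le> Suc M" "j \<le> Suc N"
  shows "e i j = D 0 0 (mx T i, my T j) - u1 i j"
proof (cases "i \<in> {1..M} \<and> j \<in> {1..N}")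
  case True
  then show ?thesis by (simp add: grid_error_def D_0)
next
  case False
  then have bd: "i = 0 \<or> i = Suc M \<or> j = 0 \<or> j = Suc N" using assms by auto
  then have "u (mx T i, my T j) = 0"
    using x.point_unit[OF assms(1)] y.point_unit[OF assms(2)] x.p_0 x.p_end y.p_0 y.p_end
    by (intro u_boundary) auto
  moreover have "u1 i j = 0"
    using u1 bd assms by (auto simp: is_first_correction_def)
  ultimately show ?thesis using False by (simp add: grid_error_def D_0)
qed

lemma zero_trace_grid_error: "zero_trace e"
  by (auto simp: zero_trace_def grid_error_def)

definition corrected_flux_x :: "nat \<Rightarrow> nat \<Rightarrow> real" where
  "corrected_flux_x i j = flux_error_x 0 0 i j + gamma_x T v i j + transverse_x i j"

definition corrected_flux_y :: "nat \<Rightarrow> nat \<Rightarrow> real" where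
  "corrected_flux_y i j = flux_error_y 0 0 i j + gamma_y T f v i j + transverse_y i j"

definition transverse_residual :: "nat \<Rightarrow> nat \<Rightarrow> real" where
  "transverse_residual i j = (transverse_x i j - transverse_x (i - 1) j)
     + (transverse_y i j - transverse_y i (j - 1)) - delta T f v i j"

text \<open>
  The transverse terms are added to the fluxes and subtracted again in the residual: in the fluxes
  they cancel the first-order defect, in the residual they meet \<open>\<delta>\<close>.
\<close>

lemma error_equation:
  assumes i: "i \<in> {1..M}" and j: "j \<in> {1..N}"
  shows "discrete_laplacian T e i j =
    - (corrected_flux_x i j - corrected_flux_x (i - 1) j)
    - (corrected_flux_y i j - corrected_flux_y i (j - 1)) + transverse_residual i j"
proof -
  have "discrete_laplacian T e i j =
      discrete_laplacian T (\<lambda>i j. D 0 0 (mx T i, my T j) - u1 i j) i j"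
    by (rule discrete_laplacian_cong[OF i j]) (rule grid_error_eq)
  also have "\<dots> = discrete_laplacian T (\<lambda>i j. D 0 0 (mx T i, my T j)) i j
      - discrete_laplacian T u1 i j"
    by (rule discrete_laplacian_diff)
  also have "discrete_laplacian T (\<lambda>i j. D 0 0 (mx T i, my T j)) i j =
      - (flux_error_x 0 0 i j - flux_error_x 0 0 (i - 1) j)
      - (flux_error_y 0 0 i j - flux_error_y 0 0 i (j - 1)) + integral (cell T i j) f"
  proof -
    have "integral (cell T i j) (\<lambda>p. D (Suc (Suc 0)) 0 p + D 0 (Suc (Suc 0)) p)
        = integral (cell T i j) (\<lambda>p. - f p)"
    proof (rule integral_cong)
      fix p assume "p \<in> cell T i j"
      then have "p \<in> Omega_bar"
        using x_cell[OF i] y_cell[OF j] by (auto simp: cell_def Omega_bar_def)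
      from f_eq[OF this] show "D (Suc (Suc 0)) 0 p + D 0 (Suc (Suc 0)) p = - f p"
        unfolding numeral_2_eq_2 by linarith
    qed
    then show ?thesis
      using discrete_laplacian_D[OF i j, of 0 0] by simp
  qed
  also have "discrete_laplacian T u1 i j = integral (cell T i j) f
      + (gamma_x T v i j - gamma_x T v (i - 1) j)
      + (gamma_y T f v i j - gamma_y T f v i (j - 1)) + delta T f v i j"
    using u1 i j by (simp add: is_first_correction_def)
  finally show ?thesis
    unfolding corrected_flux_x_def corrected_flux_y_def transverse_residual_def by linarith
qed

text \<open>
  After correction, what remains of the leading flux error is the change of \<open>u\<^sub>x\<^sub>x\<close> from the edge
  to the mesh point and the error of \<open>v\<close>, both multiplied by the offset of the edge from the midpoint.
\<close>

lemma corrected_flux_x_bound: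
  assumes i: "i \<le> M" and j: "j \<in> {1..N}"
  shows "\<bar>corrected_flux_x i j\<bar> \<le> mk T j * (3 * B * H\<^sup>2 + H * \<bar>w i j\<bar>)"
proof -
  define k where "k = mk T j"
  define c where "c = (h_minus T (Suc i) - h_plus T i) / 2"
  have k: "0 \<le> k" using y.w_nonneg j by (auto simp: k_def)
  have c: "\<bar>c\<bar> \<le> H / 2"
    using x_local[OF i] by (auto simp: c_def h_minus_def h_plus_def abs_le_iff)
  let ?dphi = "D 2 0 (x_half T i, my T j) - D 2 0 (mx T i, my T j)"
  have "\<bar>?dphi\<bar> \<le> B * \<bar>x_half T i - mx T i\<bar>"
    by (rule increment_bound[where g' = "\<lambda>t. D (Suc 2) 0 (t, my T j)"])
       (use x_local[OF i] y_cell[OF j] in \<open>auto intro!: D_x' D_bound\<close>)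
  also have "\<dots> \<le> B * H"
    using x_local[OF i] B_nonneg by (intro mult_left_mono) auto
  finally have "\<bar>?dphi + w i j\<bar> \<le> B * H + \<bar>w i j\<bar>" by simp
  then have "\<bar>c * (?dphi + w i j)\<bar> \<le> H / 2 * (B * H + \<bar>w i j\<bar>)"
    unfolding abs_mult using c by (intro mult_mono) auto
  also have "\<dots> \<le> H * (B * H + \<bar>w i j\<bar>)"
    using B_nonneg x.H_pos by (intro mult_right_mono) auto
  finally have "k * \<bar>c * (?dphi + w i j)\<bar> \<le> k * (H * (B * H + \<bar>w i j\<bar>))"
    using k by (rule mult_left_mono)
  then have "\<bar>k * (c * (?dphi + w i j))\<bar> \<le> k * (H * (B * H + \<bar>w i j\<bar>))"
    using k by (simp add: abs_mult)
  moreover have "corrected_flux_x i j =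
      (flux_error_x 0 0 i j - (k * c * D 2 0 (x_half T i, my T j) - transverse_x i j))
      + k * (c * (?dphi + w i j))"
    by (simp add: corrected_flux_x_def gamma_x_def uxx_error_def k_def c_def field_simps)
  moreover have "\<bar>flux_error_x 0 0 i j - (k * c * D 2 0 (x_half T i, my T j) - transverse_x i j)\<bar>
      \<le> k * (2 * B * H\<^sup>2)"
    using flux_error_x_second_order[OF i j] by (simp only: k_def c_def)
  ultimately have "\<bar>corrected_flux_x i j\<bar> \<le> k * (2 * B * H\<^sup>2) + k * (H * (B * H + \<bar>w i j\<bar>))"
    by linarith
  also have "\<dots> = k * (3 * B * H\<^sup>2 + H * \<bar>w i j\<bar>)"
    by (simp add: algebra_simps power2_eq_square)
  finally show ?thesis by (simp add: k_def)
qed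

text \<open>
  Here the correction uses \<open>- f - v\<close> in place of \<open>u\<^sub>y\<^sub>y\<close>. By the equation its error is again that of \<open>v\<close>, with
  the opposite sign, once \<open>u\<^sub>x\<^sub>x\<close> is moved from the edge to the mesh point.
\<close>

lemma corrected_flux_y_bound:
  assumes i: "i \<in> {1..M}" and j: "j \<le> N"
  shows "\<bar>corrected_flux_y i j\<bar> \<le> mh T i * (3 * B * H\<^sup>2 + H * \<bar>w i j\<bar>)"
proof -
  define k where "k = mh T i"
  define c where "c = (k_minus T (Suc j) - k_plus T j) / 2"
  have k: "0 \<le> k" using x.w_nonneg i by (auto simp: k_def)
  have c: "\<bar>c\<bar> \<le> H / 2"
    using y_local[OF j] by (auto simp: c_def k_minus_def k_plus_def abs_le_iff)
  let ?dphi = "D 2 0 (mx T i, y_half T j) - D 2 0 (mx T i, my T j)"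
  have "\<bar>?dphi\<bar> \<le> B * \<bar>y_half T j - my T j\<bar>"
    by (rule increment_bound[where g' = "\<lambda>t. D 2 (Suc 0) (mx T i, t)"])
       (use y_local[OF j] x_cell[OF i] in \<open>auto intro!: D_y' D_bound\<close>)
  also have "\<dots> \<le> B * H"
    using y_local[OF j] B_nonneg by (intro mult_left_mono) auto
  finally have "\<bar>?dphi + w i j\<bar> \<le> B * H + \<bar>w i j\<bar>" by simp
  then have "\<bar>c * (?dphi + w i j)\<bar> \<le> H / 2 * (B * H + \<bar>w i j\<bar>)"
    unfolding abs_mult using c by (intro mult_mono) auto
  also have "\<dots> \<le> H * (B * H + \<bar>w i j\<bar>)"
    using B_nonneg x.H_pos by (intro mult_right_mono) auto
  finally have "k * \<bar>c * (?dphi + w i j)\<bar> \<le> k * (H * (B * H + \<bar>w i j\<bar>))"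
    using k by (rule mult_left_mono)
  then have "\<bar>k * (c * (?dphi + w i j))\<bar> \<le> k * (H * (B * H + \<bar>w i j\<bar>))"
    using k by (simp add: abs_mult)
  moreover have "corrected_flux_y i j =
      (flux_error_y 0 0 i j - (k * c * D 0 2 (mx T i, y_half T j) - transverse_y i j))
      - k * (c * (?dphi + w i j))"
  proof -
    have "(mx T i, y_half T j) \<in> Omega_bar"
      using y_local[OF j] x_cell[OF i] by (auto simp: Omega_bar_def)
    from f_eq[OF this] have f: "f (mx T i, y_half T j) =
        - (D 2 0 (mx T i, y_half T j) + D 0 2 (mx T i, y_half T j))" .
    show ?thesis
      unfolding corrected_flux_y_def gamma_y_def uxx_error_def k_def c_def f
      by (simp add: field_simps)
  qed
  moreover have "\<bar>flux_error_y 0 0 i j - (k * c * D 0 2 (mx T i, y_half T j) - transverse_y i j)\<bar>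
      \<le> k * (2 * B * H\<^sup>2)"
    using flux_error_y_second_order[OF i j] by (simp only: k_def c_def)
  ultimately have "\<bar>corrected_flux_y i j\<bar> \<le> k * (2 * B * H\<^sup>2) + k * (H * (B * H + \<bar>w i j\<bar>))"
    by linarith
  also have "\<dots> = k * (3 * B * H\<^sup>2 + H * \<bar>w i j\<bar>)"
    by (simp add: algebra_simps power2_eq_square)
  finally show ?thesis by (simp add: k_def)
qed

lemma flux_bound_square:
  "(3 * B * H\<^sup>2 + H * \<bar>z\<bar>)\<^sup>2 \<le> 18 * (B\<^sup>2 * H ^ 4) + 2 * H\<^sup>2 * z\<^sup>2"
proof -
  have "(a + b)\<^sup>2 \<le> 2 * a\<^sup>2 + 2 * b\<^sup>2" for a b :: real
    using sum_squares_bound[of a b] by (simp add: power2_eq_square algebra_simps)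
  from this[of "3 * B * H\<^sup>2" "H * \<bar>z\<bar>"] show ?thesis
    by (simp add: power_mult_distrib flip: power_mult)
qed

lemma corrected_flux_x_total:
  "(\<Sum>i=0..M. \<Sum>j=1..N. mk T j * h_half T i * (3 * B * H\<^sup>2 + H * \<bar>w i j\<bar>)\<^sup>2) \<le> 50 * (B\<^sup>2 * H ^ 4)"
proof -
  have "(\<Sum>i=0..M. \<Sum>j=1..N. mk T j * h_half T i * (3 * B * H\<^sup>2 + H * \<bar>w i j\<bar>)\<^sup>2)
      \<le> (\<Sum>i=0..M. \<Sum>j=1..N. mk T j * h_half T i * (18 * (B\<^sup>2 * H ^ 4) + 2 * H\<^sup>2 * (w i j)\<^sup>2))"
    using h_half_pos y.w_nonneg
    by (intro sum_mono mult_left_mono flux_bound_square) (auto simp: less_imp_le)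
  also have "\<dots> = (\<Sum>i=0..M. \<Sum>j=1..N. mk T j * h_half T i * (18 * (B\<^sup>2 * H ^ 4)))
      + 2 * H\<^sup>2 * (\<Sum>i=0..M. \<Sum>j=1..N. mk T j * h_half T i * (w i j)\<^sup>2)"
    by (simp add: sum_distrib_left distrib_left sum.distrib mult_ac)
  also have "(\<Sum>i=0..M. \<Sum>j=1..N. mk T j * h_half T i * (18 * (B\<^sup>2 * H ^ 4))) = 18 * (B\<^sup>2 * H ^ 4)"
    by (rule sum_weights_xy)
  finally have 1: "(\<Sum>i=0..M. \<Sum>j=1..N. mk T j * h_half T i * (3 * B * H\<^sup>2 + H * \<bar>w i j\<bar>)\<^sup>2)
      \<le> 18 * (B\<^sup>2 * H ^ 4) + 2 * H\<^sup>2 * (\<Sum>i=0..M. \<Sum>j=1..N. mk T j * h_half T i * (w i j)\<^sup>2)" .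
  have "(\<Sum>i=0..M. \<Sum>j=1..N. mk T j * h_half T i * (w i j)\<^sup>2)
      \<le> (\<Sum>i=0..M. \<Sum>j=0..N. mk T j * h_half T i * (w i j)\<^sup>2)"
    by (rule sum_mono, rule sum_tail_le) (use h_half_pos y.w_nonneg in \<open>auto simp: less_imp_le\<close>)
  also have "\<dots> \<le> energy_x w"
    by (rule poincare_x[OF zero_trace_uxx_error _ sum_h_half]) (simp add: h_half_pos less_imp_le)
  also have "\<dots> \<le> 16 * (B\<^sup>2 * H\<^sup>2)"
    using uxx_error_bound energy_y_nonneg[of w] by linarith
  finally have "2 * H\<^sup>2 * (\<Sum>i=0..M. \<Sum>j=1..N. mk T j * h_half T i * (w i j)\<^sup>2)
      \<le> 2 * H\<^sup>2 * (16 * (B\<^sup>2 * H\<^sup>2))"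
    by (rule mult_left_mono) simp
  also have "\<dots> = 32 * (B\<^sup>2 * H ^ 4)"
    by (simp add: power2_eq_square power4_eq_xxxx)
  finally show ?thesis using 1 by linarith
qed

lemma corrected_flux_y_total:
  "(\<Sum>i=1..M. \<Sum>j=0..N. mh T i * k_half T j * (3 * B * H\<^sup>2 + H * \<bar>w i j\<bar>)\<^sup>2) \<le> 50 * (B\<^sup>2 * H ^ 4)"
proof -
  have "(\<Sum>i=1..M. \<Sum>j=0..N. mh T i * k_half T j * (3 * B * H\<^sup>2 + H * \<bar>w i j\<bar>)\<^sup>2)
      \<le> (\<Sum>i=1..M. \<Sum>j=0..N. mh T i * k_half T j * (18 * (B\<^sup>2 * H ^ 4) + 2 * H\<^sup>2 * (w i j)\<^sup>2))"
    using k_half_pos x.w_nonneg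
    by (intro sum_mono mult_left_mono flux_bound_square) (auto simp: less_imp_le)
  also have "\<dots> = (\<Sum>i=1..M. \<Sum>j=0..N. mh T i * k_half T j * (18 * (B\<^sup>2 * H ^ 4)))
      + 2 * H\<^sup>2 * (\<Sum>i=1..M. \<Sum>j=0..N. mh T i * k_half T j * (w i j)\<^sup>2)"
    by (simp add: sum_distrib_left distrib_left sum.distrib mult_ac)
  also have "(\<Sum>i=1..M. \<Sum>j=0..N. mh T i * k_half T j * (18 * (B\<^sup>2 * H ^ 4))) = 18 * (B\<^sup>2 * H ^ 4)"
    by (rule sum_weights_xy)
  finally have 1: "(\<Sum>i=1..M. \<Sum>j=0..N. mh T i * k_half T j * (3 * B * H\<^sup>2 + H * \<bar>w i j\<bar>)\<^sup>2)
      \<le> 18 * (B\<^sup>2 * H ^ 4) + 2 * H\<^sup>2 * (\<Sum>i=1..M. \<Sum>j=0..N. mh T i * k_half T j * (w i j)\<^sup>2)" .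
  have "(\<Sum>i=1..M. \<Sum>j=0..N. mh T i * k_half T j * (w i j)\<^sup>2)
      \<le> (\<Sum>i=0..M. \<Sum>j=0..N. mh T i * k_half T j * (w i j)\<^sup>2)"
    by (rule sum_tail_le) (use k_half_pos x.w_nonneg in \<open>auto intro!: sum_nonneg simp: less_imp_le\<close>)
  also have "\<dots> \<le> energy_y w"
    by (rule poincare_y[OF zero_trace_uxx_error _ sum_k_half]) (simp add: k_half_pos less_imp_le)
  also have "\<dots> \<le> 16 * (B\<^sup>2 * H\<^sup>2)"
    using uxx_error_bound energy_x_nonneg[of w] by linarith
  finally have "2 * H\<^sup>2 * (\<Sum>i=1..M. \<Sum>j=0..N. mh T i * k_half T j * (w i j)\<^sup>2)
      \<le> 2 * H\<^sup>2 * (16 * (B\<^sup>2 * H\<^sup>2))"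
    by (rule mult_left_mono) simp
  also have "\<dots> = 32 * (B\<^sup>2 * H ^ 4)"
    by (simp add: power2_eq_square power4_eq_xxxx)
  finally show ?thesis using 1 by linarith
qed

definition residual_weight :: "nat \<Rightarrow> nat \<Rightarrow> real" where
  "residual_weight i j = 5 * (B * H\<^sup>2)
     + k_plus T j / 2 * \<bar>diff_y T w i j\<bar> + k_minus T j / 2 * \<bar>diff_y T w i (j - 1)\<bar>
     + h_plus T i / 2 * \<bar>diff_x T w i j\<bar> + h_minus T i / 2 * \<bar>diff_x T w (i - 1) j\<bar>"

lemma diff_y_split:
  "diff_y T v i j = diff_y T (\<lambda>i j. D 2 0 (mx T i, my T j)) i j + - diff_y T w i j"
  by (simp add: diff_y_def uxx_error_def diff_divide_distrib)

lemma diff_x_split: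
  "diff_x T v i j = diff_x T (\<lambda>i j. D 2 0 (mx T i, my T j)) i j - diff_x T w i j"
  by (simp add: diff_x_def uxx_error_def diff_divide_distrib)

lemma diff_y_consistent:
  assumes i: "i \<in> {1..M}" and j: "j \<le> N" and m: "m \<in> {my T j..my T (Suc j)}"
  shows "\<bar>diff_y T (\<lambda>i j. D 2 0 (mx T i, my T j)) i j - D 2 1 (mx T i, m)\<bar> \<le> 2 * (B * H)"
proof -
  have "\<bar>D 2 0 (mx T i, my T (Suc j)) - D 2 0 (mx T i, my T j)
      - (my T (Suc j) - my T j) * D 2 (Suc 0) (mx T i, m)\<bar>
      \<le> (my T (Suc j) - my T j) * (B * (2 * H))"
    by (rule difference_first_order[where g'' = "\<lambda>t. D 2 (Suc (Suc 0)) (mx T i, t)"])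
       (use m y_local[OF j] x_cell[OF i] in \<open>auto intro!: D_y' D_bound\<close>)
  from rescaled_difference_quotient[where k = 1 and ?c1.0 = 0 and ?c0.0 = "D 2 (Suc 0) (mx T i, m)"
      and p = "my T j" and q = "my T (Suc j)" and E = "B * (2 * H)"
      and A = "D 2 0 (mx T i, my T (Suc j)) - D 2 0 (mx T i, my T j)"] this y.gap_pos[OF j]
  show ?thesis by (simp add: diff_y_def k_half_def mult_ac)
qed

lemma diff_x_consistent:
  assumes i: "i \<le> M" and j: "j \<in> {1..N}" and m: "m \<in> {mx T i..mx T (Suc i)}"
  shows "\<bar>diff_x T (\<lambda>i j. D 2 0 (mx T i, my T j)) i j - D 3 0 (m, my T j)\<bar> \<le> 2 * (B * H)"
proof -
  have "\<bar>D 2 0 (mx T (Suc i), my T j) - D 2 0 (mx T i, my T j)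
      - (mx T (Suc i) - mx T i) * D (Suc 2) 0 (m, my T j)\<bar>
      \<le> (mx T (Suc i) - mx T i) * (B * (2 * H))"
    by (rule difference_first_order[where g'' = "\<lambda>t. D (Suc (Suc 2)) 0 (t, my T j)"])
       (use m x_local[OF i] y_cell[OF j] in \<open>auto intro!: D_x' D_bound\<close>)
  from rescaled_difference_quotient[where k = 1 and ?c1.0 = 0 and ?c0.0 = "D (Suc 2) 0 (m, my T j)"
      and p = "mx T i" and q = "mx T (Suc i)" and E = "B * (2 * H)"
      and A = "D 2 0 (mx T (Suc i), my T j) - D 2 0 (mx T i, my T j)"] this x.gap_pos[OF i]
  show ?thesis by (simp add: diff_x_def h_half_def mult_ac eval_nat_numeral)
qed

text \<open>
  The \<open>x\<close>-fluxes lead to \<open>u\<^sub>x\<^sub>x\<^sub>y\<close>, approximated by the \<open>y\<close>-quotient of \<open>v\<close>; the \<open>y\<close>-fluxes lead to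
  \<open>u\<^sub>x\<^sub>y\<^sub>y = - f\<^sub>x - u\<^sub>x\<^sub>x\<^sub>x\<close>, approximated by \<open>- f\<^sub>x\<close> minus the \<open>x\<close>-quotient of \<open>v\<close>.
\<close>

lemma transverse_residual_bound:
  assumes i: "i \<in> {1..M}" and j: "j \<in> {1..N}"
  shows "\<bar>transverse_residual i j\<bar> \<le> mh T i * mk T j * residual_weight i j"
proof -
  let ?phi = "\<lambda>i j. D 2 0 (mx T i, my T j)"
  have xs: "0 \<le> h_plus T i" "0 \<le> h_minus T i" "h_plus T i + h_minus T i = mh T i"
    "mh T i \<le> H" "0 \<le> mh T i" "h_plus T i \<le> H" "h_minus T i \<le> H"
    using x_cell[OF i] widths_le(1)[OF i] by (auto simp: h_plus_def h_minus_def)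
  have ys: "0 \<le> k_plus T j" "0 \<le> k_minus T j" "k_plus T j + k_minus T j = mk T j"
    "mk T j \<le> H" "0 \<le> mk T j" "k_plus T j \<le> H" "k_minus T j \<le> H"
    using y_cell[OF j] widths_le(2)[OF j] by (auto simp: k_plus_def k_minus_def)
  have K: "0 \<le> B * H" using B_nonneg x.H_pos by simp
  have i1: "i - 1 \<le> M" "Suc (i - 1) = i" and j1: "j - 1 \<le> N" "Suc (j - 1) = j"
    and iM: "i \<le> M" and jN: "j \<le> N" using i j by auto
  have X: "\<bar>(transverse_x i j - transverse_x (i - 1) j)
      - (mh T i * ((k_plus T j)\<^sup>2 / 2) * diff_y T v i j
         - mh T i * ((k_minus T j)\<^sup>2 / 2) * diff_y T v i (j - 1))\<bar>
      \<le> mh T i * mk T j * (5 / 2 * (B * H * H) + k_plus T j / 2 * \<bar>diff_y T w i j\<bar>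
          + k_minus T j / 2 * \<bar>diff_y T w i (j - 1)\<bar>)"
  proof -
    let ?r = "D 1 1 (x_half T i, my T j) - D 1 1 (x_half T (i - 1), my T j)"
    have r: "\<bar>?r - mh T i * D (Suc 1) 1 (mx T i, my T j)\<bar> \<le> mh T i * (B * H)"
      unfolding x_cell(7)[OF i, symmetric]
      by (rule difference_first_order[where g'' = "\<lambda>t. D (Suc (Suc 1)) 1 (t, my T j)"])
         (use x_cell[OF i] y_cell[OF j] in \<open>auto intro!: D_x' D_bound\<close>)
    have "\<bar>diff_y T ?phi i j - D 2 1 (mx T i, my T j)\<bar> \<le> 2 * (B * H)"
      by (rule diff_y_consistent[OF i jN]) (use y.gap_pos[OF jN] in auto)
    moreover have "\<bar>diff_y T ?phi i (j - 1) - D 2 1 (mx T i, my T j)\<bar> \<le> 2 * (B * H)"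
      by (rule diff_y_consistent[OF i j1(1)]) (use y.gap_pos[OF j1(1), unfolded j1(2)] j1(2) in simp)
    ultimately have d: "\<bar>diff_y T ?phi i j - D (Suc 1) 1 (mx T i, my T j)\<bar> \<le> 4 * (B * H)"
      "\<bar>diff_y T ?phi i (j - 1) - D (Suc 1) 1 (mx T i, my T j)\<bar> \<le> 4 * (B * H)"
      using K unfolding numeral_2_eq_2 One_nat_def by linarith+
    have s: "transverse_x i j - transverse_x (i - 1) j =
        ((k_plus T j)\<^sup>2 - (k_minus T j)\<^sup>2) / 2 * ?r"
      by (simp only: transverse_x_def right_diff_distrib)
    have sum_le: "k_plus T j + k_minus T j \<le> H" using ys by linarith
    show ?thesis
      unfolding s diff_y_split
      using transverse_residual_split_bound[OF ys(1,2) sum_le xs(5) K r d,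
          of "- diff_y T w i j" "- diff_y T w i (j - 1)"]
      unfolding ys(3) abs_minus_cancel .
  qed
  have Y: "\<bar>(transverse_y i j - transverse_y i (j - 1))
      - (mk T j * ((h_plus T i)\<^sup>2 / 2) * (- pdx f (mx T i, my T j) - diff_x T v i j)
         - mk T j * ((h_minus T i)\<^sup>2 / 2) * (- pdx f (mx T (i - 1), my T j) - diff_x T v (i - 1) j))\<bar>
      \<le> mh T i * mk T j * (5 / 2 * (B * H * H) + h_plus T i / 2 * \<bar>diff_x T w i j\<bar>
          + h_minus T i / 2 * \<bar>diff_x T w (i - 1) j\<bar>)"
  proof -
    let ?r = "D 1 1 (mx T i, y_half T j) - D 1 1 (mx T i, y_half T (j - 1))"
    have r: "\<bar>?r - mk T j * D 1 (Suc 1) (mx T i, my T j)\<bar> \<le> mk T j * (B * H)"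
      unfolding y_cell(7)[OF j, symmetric]
      by (rule difference_first_order[where g'' = "\<lambda>t. D 1 (Suc (Suc 1)) (mx T i, t)"])
         (use x_cell[OF i] y_cell[OF j] in \<open>auto intro!: D_y' D_bound\<close>)
    have fx: "- pdx f (mx T l, my T j) = D 3 0 (mx T l, my T j) + D 1 2 (mx T l, my T j)"
      if "l \<le> M" for l
      using pdx_f_eq[of "(mx T l, my T j)"] x_local[OF that] y_cell[OF j]
      by (auto simp: Omega_bar_def)
    let ?e = "\<lambda>l. - pdx f (mx T l, my T j) - diff_x T ?phi l j"
    have c0: "\<bar>diff_x T ?phi i j - D 3 0 (mx T i, my T j)\<bar> \<le> 2 * (B * H)"
      by (rule diff_x_consistent[OF iM j]) (use x.gap_pos[OF iM] in auto)
    have c1: "\<bar>diff_x T ?phi (i - 1) j - D 3 0 (mx T (i - 1), my T j)\<bar> \<le> 2 * (B * H)"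
      by (rule diff_x_consistent[OF i1(1) j]) (use x.gap_pos[OF i1(1), unfolded i1(2)] i1(2) in simp)
    \<comment> \<open>The term \<open>\<delta>\<close> evaluates \<open>f\<^sub>x\<close> at the left neighbour, which costs another first-order error.\<close>
    have "\<bar>D 1 2 (mx T (i - 1), my T j) - D 1 2 (mx T i, my T j)\<bar> \<le> B * \<bar>mx T (i - 1) - mx T i\<bar>"
    proof (rule increment_bound[where g = "\<lambda>t. D 1 2 (t, my T j)" and g' = "\<lambda>t. D 2 2 (t, my T j)"])
      have y: "my T j \<in> {0..1}" using jN by (intro y.point_unit) simp
      show "((\<lambda>t. D 1 2 (t, my T j)) has_real_derivative D 2 2 (t, my T j)) (at t within {0..1})"
        if "t \<in> {0..1}" for t
        by (rule D_x'[OF _ _ that y]) simp_all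
      show "\<bar>D 2 2 (t, my T j)\<bar> \<le> B" if "t \<in> {0..1}" for t
        by (rule D_bound[OF _ that y]) simp
      show "mx T (i - 1) \<in> {0..1}" "mx T i \<in> {0..1}"
        using i1(1) iM by (intro x.point_unit; simp)+
    qed
    also have "\<dots> \<le> B * (2 * H)"
      using x.gap_pos[OF i1(1), unfolded i1(2)] x.gap_le[OF i1(1), unfolded i1(2)] B_nonneg
      by (intro mult_left_mono) auto
    finally have c2: "\<bar>D 1 2 (mx T (i - 1), my T j) - D 1 2 (mx T i, my T j)\<bar> \<le> 2 * (B * H)"
      by simp
    have d: "\<bar>?e i - D 1 (Suc 1) (mx T i, my T j)\<bar> \<le> 4 * (B * H)"
      "\<bar>?e (i - 1) - D 1 (Suc 1) (mx T i, my T j)\<bar> \<le> 4 * (B * H)"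
      using c0 c1 c2 K unfolding fx[OF iM] fx[OF i1(1)] Suc_1 by linarith+
    have s: "transverse_y i j - transverse_y i (j - 1) =
        ((h_plus T i)\<^sup>2 - (h_minus T i)\<^sup>2) / 2 * ?r"
      by (simp only: transverse_y_def right_diff_distrib)
    have split: "- pdx f (mx T l, my T j) - diff_x T v l j = ?e l + diff_x T w l j" for l
      unfolding diff_x_split by linarith
    have sum_le: "h_plus T i + h_minus T i \<le> H" using xs by linarith
    show ?thesis
      unfolding s split
      by (subst mult.commute[of "mh T i" "mk T j"])
         (rule transverse_residual_split_bound[OF xs(1,2) sum_le ys(5) K r d, unfolded xs(3)])
  qed
  let ?h = "mh T i * mk T j"
  have triangle: "\<bar>p + q - (a - b + c - d)\<bar> \<le> E1 + E2"
    if "\<bar>p - (a - b)\<bar> \<le> E1" "\<bar>q - (c - d)\<bar> \<le> E2" for p q a b c d E1 E2 :: real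
    using that by linarith
  have "\<bar>transverse_residual i j\<bar> \<le>
      ?h * (5 / 2 * (B * H * H) + k_plus T j / 2 * \<bar>diff_y T w i j\<bar>
          + k_minus T j / 2 * \<bar>diff_y T w i (j - 1)\<bar>) +
      ?h * (5 / 2 * (B * H * H) + h_plus T i / 2 * \<bar>diff_x T w i j\<bar>
          + h_minus T i / 2 * \<bar>diff_x T w (i - 1) j\<bar>)"
    unfolding transverse_residual_def delta_def by (rule triangle[OF X Y])
  also have "\<dots> = ?h * residual_weight i j"
    by (simp add: residual_weight_def distrib_left power2_eq_square mult_ac)
  finally show ?thesis .
qed

text \<open>
  The quotients of the error of \<open>v\<close> are summed with all four neighbouring edges of a cell, so each
  half of the energy is counted at most twice.
\<close>

lemma residual_weight_total:
  "(\<Sum>i=1..M. \<Sum>j=1..N. mh T i * mk T j * (residual_weight i j)\<^sup>2) \<le> 165 * (B\<^sup>2 * H ^ 4)"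
proof -
  let ?ex = "\<lambda>i j. mk T j * ((w (Suc i) j - w i j)\<^sup>2 / h_half T i)"
  let ?ey = "\<lambda>i j. mh T i * ((w i (Suc j) - w i j)\<^sup>2 / k_half T j)"
  have ex0: "0 \<le> ?ex i j" if "i \<le> M" "j \<le> N" for i j
    using that h_half_pos y.w_nonneg by (auto intro!: mult_nonneg_nonneg divide_nonneg_pos)
  have ey0: "0 \<le> ?ey i j" if "i \<le> M" "j \<le> N" for i j
    using that k_half_pos x.w_nonneg by (auto intro!: mult_nonneg_nonneg divide_nonneg_pos)
  have pointwise: "mh T i * mk T j * (residual_weight i j)\<^sup>2 \<le>
      mh T i * mk T j * (125 * (B\<^sup>2 * H ^ 4)) +
      5 / 4 * H\<^sup>2 * (?ey i j + ?ey i (j - 1) + (?ex i j + ?ex (i - 1) j))"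
    if i: "i \<in> {1..M}" and j: "j \<in> {1..N}" for i j
  proof -
    have i1: "i - 1 \<le> M" "Suc (i - 1) = i" and j1: "j - 1 \<le> N" "Suc (j - 1) = j"
      and iM: "i \<le> M" and jN: "j \<le> N" using i j by auto
    have w: "0 \<le> mh T i" "mh T i \<le> H" "0 \<le> mk T j" "mk T j \<le> H"
      using x.w_nonneg[OF iM] y.w_nonneg[OF jN] widths_le(1)[OF i] widths_le(2)[OF j] by auto
    have gaps: "0 < h_half T i" "0 < h_half T (i - 1)" "0 < k_half T j" "0 < k_half T (j - 1)"
      using h_half_pos k_half_pos iM i1 jN j1 by auto
    have hp: "0 \<le> h_plus T i" "h_plus T i \<le> H" "h_plus T i \<le> h_half T i"
      "0 \<le> h_minus T i" "h_minus T i \<le> H" "h_minus T i \<le> h_half T (i - 1)"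
      using x_local[OF iM] x_local[OF i1(1), unfolded i1(2)] i1(2)
      by (simp_all add: h_plus_def h_minus_def h_half_def)
    have kp: "0 \<le> k_plus T j" "k_plus T j \<le> H" "k_plus T j \<le> k_half T j"
      "0 \<le> k_minus T j" "k_minus T j \<le> H" "k_minus T j \<le> k_half T (j - 1)"
      using y_local[OF jN] y_local[OF j1(1), unfolded j1(2)] j1(2)
      by (simp_all add: k_plus_def k_minus_def k_half_def)
    let ?h = "mh T i * mk T j"
    have 1: "?h * (k_plus T j / 2 * \<bar>diff_y T w i j\<bar>)\<^sup>2 \<le> H\<^sup>2 / 4 * ?ey i j"
      unfolding diff_y_def add.commute[of _ 1] plus_1_eq_Suc
      by (rule weighted_quotient_bound) (use w kp gaps in auto)
    have 2: "?h * (k_minus T j / 2 * \<bar>diff_y T w i (j - 1)\<bar>)\<^sup>2 \<le> H\<^sup>2 / 4 * ?ey i (j - 1)"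
      unfolding diff_y_def add.commute[of _ 1] plus_1_eq_Suc
      by (rule weighted_quotient_bound) (use w kp gaps in auto)
    have 3: "?h * (h_plus T i / 2 * \<bar>diff_x T w i j\<bar>)\<^sup>2 \<le> H\<^sup>2 / 4 * ?ex i j"
      unfolding diff_x_def add.commute[of _ 1] plus_1_eq_Suc
      by (subst mult.commute[of "mh T i" "mk T j"], rule weighted_quotient_bound) (use w hp gaps in auto)
    have 4: "?h * (h_minus T i / 2 * \<bar>diff_x T w (i - 1) j\<bar>)\<^sup>2 \<le> H\<^sup>2 / 4 * ?ex (i - 1) j"
      unfolding diff_x_def add.commute[of _ 1] plus_1_eq_Suc
      by (subst mult.commute[of "mh T i" "mk T j"], rule weighted_quotient_bound) (use w hp gaps in auto)
    have 5: "(5 * (B * H\<^sup>2))\<^sup>2 = 25 * (B\<^sup>2 * H ^ 4)"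
      by (simp add: power_mult_distrib flip: power_mult)
    have "?h * (residual_weight i j)\<^sup>2 \<le> ?h * (5 * (25 * (B\<^sup>2 * H ^ 4)
        + (k_plus T j / 2 * \<bar>diff_y T w i j\<bar>)\<^sup>2 + (k_minus T j / 2 * \<bar>diff_y T w i (j - 1)\<bar>)\<^sup>2
        + (h_plus T i / 2 * \<bar>diff_x T w i j\<bar>)\<^sup>2 + (h_minus T i / 2 * \<bar>diff_x T w (i - 1) j\<bar>)\<^sup>2))"
      unfolding residual_weight_def 5[symmetric]
      using w by (intro mult_left_mono square_sum_five_le) auto
    also have "\<dots> = ?h * (125 * (B\<^sup>2 * H ^ 4))
        + 5 * (?h * (k_plus T j / 2 * \<bar>diff_y T w i j\<bar>)\<^sup>2)
        + 5 * (?h * (k_minus T j / 2 * \<bar>diff_y T w i (j - 1)\<bar>)\<^sup>2)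
        + 5 * (?h * (h_plus T i / 2 * \<bar>diff_x T w i j\<bar>)\<^sup>2)
        + 5 * (?h * (h_minus T i / 2 * \<bar>diff_x T w (i - 1) j\<bar>)\<^sup>2)"
      by (simp only: distrib_left mult_ac)
    also have "\<dots> \<le> ?h * (125 * (B\<^sup>2 * H ^ 4)) + 5 * (H\<^sup>2 / 4 * ?ey i j)
        + 5 * (H\<^sup>2 / 4 * ?ey i (j - 1)) + 5 * (H\<^sup>2 / 4 * ?ex i j) + 5 * (H\<^sup>2 / 4 * ?ex (i - 1) j)"
      by (intro add_mono order_refl mult_left_mono[OF 1] mult_left_mono[OF 2]
          mult_left_mono[OF 3] mult_left_mono[OF 4]) simp_all
    also have "\<dots> = ?h * (125 * (B\<^sup>2 * H ^ 4)) +
        5 / 4 * H\<^sup>2 * (?ey i j + ?ey i (j - 1) + (?ex i j + ?ex (i - 1) j))"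
      by (simp only: distrib_left)
    finally show ?thesis .
  qed
  have y1: "(\<Sum>i=1..M. \<Sum>j=1..N. ?ey i j) \<le> energy_y w"
  proof -
    have "(\<Sum>i=1..M. \<Sum>j=1..N. ?ey i j) \<le> (\<Sum>i=1..M. \<Sum>j=0..N. ?ey i j)"
      by (rule sum_mono, rule sum_tail_le, rule ey0) auto
    also have "\<dots> \<le> energy_y w"
      unfolding energy_y_def by (rule sum_tail_le, rule sum_nonneg, rule ey0) auto
    finally show ?thesis .
  qed
  have y2: "(\<Sum>i=1..M. \<Sum>j=1..N. ?ey i (j - 1)) \<le> energy_y w"
  proof -
    have "(\<Sum>i=1..M. \<Sum>j=1..N. ?ey i (j - 1)) \<le> (\<Sum>i=1..M. \<Sum>j=0..N. ?ey i j)"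
      by (rule sum_mono, rule sum_shift_le, rule ey0) auto
    also have "\<dots> \<le> energy_y w"
      unfolding energy_y_def by (rule sum_tail_le, rule sum_nonneg, rule ey0) auto
    finally show ?thesis .
  qed
  have x1: "(\<Sum>i=1..M. \<Sum>j=1..N. ?ex i j) \<le> energy_x w"
  proof -
    have "(\<Sum>i=1..M. \<Sum>j=1..N. ?ex i j) \<le> (\<Sum>i=1..M. \<Sum>j=0..N. ?ex i j)"
      by (rule sum_mono, rule sum_tail_le, rule ex0) auto
    also have "\<dots> \<le> energy_x w"
      unfolding energy_x_def by (rule sum_tail_le, rule sum_nonneg, rule ex0) auto
    finally show ?thesis .
  qed
  have x2: "(\<Sum>i=1..M. \<Sum>j=1..N. ?ex (i - 1) j) \<le> energy_x w"
  proof -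
    have "(\<Sum>i=1..M. \<Sum>j=1..N. ?ex (i - 1) j) \<le> (\<Sum>i=1..M. \<Sum>j=0..N. ?ex (i - 1) j)"
      by (rule sum_mono, rule sum_tail_le, rule ex0) auto
    also have "\<dots> \<le> energy_x w"
      unfolding energy_x_def
      by (rule sum_shift_le[of M "\<lambda>i. \<Sum>j=0..N. ?ex i j"], rule sum_nonneg, rule ex0) auto
    finally show ?thesis .
  qed
  have "(\<Sum>i=1..M. \<Sum>j=1..N. mh T i * mk T j * (residual_weight i j)\<^sup>2) \<le>
      (\<Sum>i=1..M. \<Sum>j=1..N. mh T i * mk T j * (125 * (B\<^sup>2 * H ^ 4)) +
        5 / 4 * H\<^sup>2 * (?ey i j + ?ey i (j - 1) + (?ex i j + ?ex (i - 1) j)))"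
    by (intro sum_mono pointwise)
  also have "\<dots> = (\<Sum>i=1..M. \<Sum>j=1..N. mh T i * mk T j * (125 * (B\<^sup>2 * H ^ 4))) +
      5 / 4 * H\<^sup>2 * ((\<Sum>i=1..M. \<Sum>j=1..N. ?ey i j) + (\<Sum>i=1..M. \<Sum>j=1..N. ?ey i (j - 1)) +
        ((\<Sum>i=1..M. \<Sum>j=1..N. ?ex i j) + (\<Sum>i=1..M. \<Sum>j=1..N. ?ex (i - 1) j)))"
    by (simp only: sum.distrib flip: sum_distrib_left)
  also have "(\<Sum>i=1..M. \<Sum>j=1..N. mh T i * mk T j * (125 * (B\<^sup>2 * H ^ 4))) = 125 * (B\<^sup>2 * H ^ 4)"
    by (rule sum_weights_xy)
  finally have total: "(\<Sum>i=1..M. \<Sum>j=1..N. mh T i * mk T j * (residual_weight i j)\<^sup>2) \<le>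
      125 * (B\<^sup>2 * H ^ 4) +
      5 / 4 * H\<^sup>2 * ((\<Sum>i=1..M. \<Sum>j=1..N. ?ey i j) + (\<Sum>i=1..M. \<Sum>j=1..N. ?ey i (j - 1)) +
        ((\<Sum>i=1..M. \<Sum>j=1..N. ?ex i j) + (\<Sum>i=1..M. \<Sum>j=1..N. ?ex (i - 1) j)))" .
  have "(\<Sum>i=1..M. \<Sum>j=1..N. ?ey i j) + (\<Sum>i=1..M. \<Sum>j=1..N. ?ey i (j - 1)) +
        ((\<Sum>i=1..M. \<Sum>j=1..N. ?ex i j) + (\<Sum>i=1..M. \<Sum>j=1..N. ?ex (i - 1) j))
      \<le> (energy_y w + energy_y w) + (energy_x w + energy_x w)"
    using y1 y2 x1 x2 by (intro add_mono)
  also have "\<dots> \<le> 32 * (B\<^sup>2 * H\<^sup>2)"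
    using uxx_error_bound by linarith
  finally have "5 / 4 * H\<^sup>2 * ((\<Sum>i=1..M. \<Sum>j=1..N. ?ey i j) +
        (\<Sum>i=1..M. \<Sum>j=1..N. ?ey i (j - 1)) +
        ((\<Sum>i=1..M. \<Sum>j=1..N. ?ex i j) + (\<Sum>i=1..M. \<Sum>j=1..N. ?ex (i - 1) j)))
      \<le> 5 / 4 * H\<^sup>2 * (32 * (B\<^sup>2 * H\<^sup>2))"
    by (rule mult_left_mono) simp
  also have "\<dots> = 40 * (B\<^sup>2 * H ^ 4)"
    by (simp add: power2_eq_square power4_eq_xxxx)
  finally show ?thesis using total by linarith
qed

lemma corrected_error_energy: "energy_x e + energy_y e \<le> (24 * H\<^sup>2 * B)\<^sup>2"
proof -
  have "energy_x e + energy_y e \<le> 2 * (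
      (\<Sum>i=0..M. \<Sum>j=1..N. mk T j * h_half T i * (3 * B * H\<^sup>2 + H * \<bar>w i j\<bar>)\<^sup>2) +
      (\<Sum>i=1..M. \<Sum>j=0..N. mh T i * k_half T j * (3 * B * H\<^sup>2 + H * \<bar>w i j\<bar>)\<^sup>2) +
      (\<Sum>i=1..M. \<Sum>j=1..N. mh T i * mk T j * (residual_weight i j)\<^sup>2))"
    by (rule energy_estimate[OF zero_trace_grid_error error_equation
          corrected_flux_x_bound corrected_flux_y_bound transverse_residual_bound])
  also have "\<dots> \<le> 2 * (50 * (B\<^sup>2 * H ^ 4) + 50 * (B\<^sup>2 * H ^ 4) + 165 * (B\<^sup>2 * H ^ 4))"
    by (intro mult_left_mono add_mono corrected_flux_x_total corrected_flux_y_total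
        residual_weight_total) simp
  \<comment> \<open>The total is 530; the next square is 576, which gives the constant 24.\<close>
  also have "\<dots> \<le> 576 * (B\<^sup>2 * H ^ 4)"
    by simp
  also have "\<dots> = (24 * H\<^sup>2 * B)\<^sup>2"
    by (simp add: power_mult_distrib mult_ac flip: power_mult)
  finally show ?thesis .
qed

lemma corrected_error_estimates:
  "norm_1 T e \<le> 24 * H\<^sup>2 * B"
  "sqrt (\<Sum>i=0..M. \<Sum>j=0..N. mk T j * h_half T i * (e i j)\<^sup>2) \<le> 24 * H\<^sup>2 * B"
  "norm_L2 T e \<le> 24 * H\<^sup>2 * B"
proof -
  have nonneg: "0 \<le> 24 * H\<^sup>2 * B" using B_nonneg by simp
  show "norm_1 T e \<le> 24 * H\<^sup>2 * B"
    unfolding norm_1_eq using corrected_error_energy nonneg by (intro real_le_lsqrt) auto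
  have "(\<Sum>i=0..M. \<Sum>j=0..N. mk T j * h_half T i * (e i j)\<^sup>2) \<le> energy_x e"
    by (rule poincare_x[OF zero_trace_grid_error _ sum_h_half]) (simp add: h_half_pos less_imp_le)
  also have "\<dots> \<le> (24 * H\<^sup>2 * B)\<^sup>2"
    using corrected_error_energy energy_y_nonneg[of e] by linarith
  finally show "sqrt (\<Sum>i=0..M. \<Sum>j=0..N. mk T j * h_half T i * (e i j)\<^sup>2) \<le> 24 * H\<^sup>2 * B"
    using nonneg by (intro real_le_lsqrt) auto
  have "(\<Sum>i=0..M. \<Sum>j=0..N. mh T i * mk T j * (e i j)\<^sup>2) \<le> energy_y e"
    by (rule poincare_y[OF zero_trace_grid_error y.w_nonneg y.sum_w])
  also have "\<dots> \<le> (24 * H\<^sup>2 * B)\<^sup>2"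
    using corrected_error_energy energy_x_nonneg[of e] by linarith
  finally show "norm_L2 T e \<le> 24 * H\<^sup>2 * B"
    unfolding norm_L2_def using nonneg by (intro real_le_lsqrt) auto
qed

end

theorem theorem3p2:
  "\<exists>c::real. c > 0 \<and>
    (\<forall>u f.
      C_bar 4 u \<and> C_bar 2 f \<and>
      (\<forall>p\<in>Omega. - laplacian u p = f p) \<and> (\<forall>p\<in>frontier Omega. u p = 0) \<longrightarrow>
      (\<forall>T v u1.
        admissible_mesh T \<and> is_approx_uxx T f v \<and> is_first_correction T f v u1 \<longrightarrow>
        norm_1 T (grid_error T u u1) \<le> c * (mesh_size T)\<^sup>2 * max_norm 4 u \<and>
        sqrt (\<Sum>i=0..mM T. \<Sum>j=0..mN T. mk T j * h_half T i * (grid_error T u u1 i j)\<^sup>2)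
          \<le> c * (mesh_size T)\<^sup>2 * max_norm 4 u \<and>
        norm_L2 T (grid_error T u u1) \<le> c * (mesh_size T)\<^sup>2 * max_norm 4 u))"
proof (intro exI[of _ 24] conjI allI impI)
  show "0 < (24 :: real)" by simp
next
  fix u f T v u1
  assume "C_bar 4 u \<and> C_bar 2 f \<and>
      (\<forall>p\<in>Omega. - laplacian u p = f p) \<and> (\<forall>p\<in>frontier Omega. u p = 0)"
    and "admissible_mesh T \<and> is_approx_uxx T f v \<and> is_first_correction T f v u1"
  then interpret corrected_scheme u f T v u1
    by unfold_locales auto
  show "norm_1 T (grid_error T u u1) \<le> 24 * (mesh_size T)\<^sup>2 * max_norm 4 u"
    "sqrt (\<Sum>i=0..mM T. \<Sum>j=0..mN T. mk T j * h_half T i * (grid_error T u u1 i j)\<^sup>2)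
      \<le> 24 * (mesh_size T)\<^sup>2 * max_norm 4 u"
    "norm_L2 T (grid_error T u u1) \<le> 24 * (mesh_size T)\<^sup>2 * max_norm 4 u"
    by (fact corrected_error_estimates)+
qed

end
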